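(* Let $\delta\in(0,1)$ and $\tau\in(0,\frac12)$. Let $n,K,M$ be positive integers such that $$n\ge\frac{9\log(2/\delta)}{2\tau^2},\qquad K\ge\frac{\log(2/\delta)}{2(\frac12-\tau)^2},\qquad M=\left\lfloor\frac{2n\tau^2}{9\log(2/\delta)}\right\rfloor.$$ Let $X_1,\dots,X_n$ be i.i.d. in a measurable space $\mathcal{Z}$, and let $h:\mathcal{Z}\times\mathcal{Z}\to\mathbb{R}$ be a symmetric measurable kernel with $\mathbb{E}[h(X_1,X_2)^2]<\infty$ and $\theta(h)=\mathbb{E}[h(X_1,X_2)]$. Let $\widetilde\theta_{\mathrm{MoIU}}(h)$ be the median-of-incomplete-U-statistics estimator with $K$ independent blocks, each consisting of $M$ pairs drawn without replacement within the block (as defined in the context). Then, with probability at least $1-\delta$, $$\left|\widetilde\theta_{\mathrm{MoIU}}(h)-\theta(h)\right|\le\sqrt{\frac{12\sigma_1^2(h)}{n\tau}+\frac{6\sigma_2^2(h)}{\tau n(n-1)}+\frac{27\sigma^2(h)\log(2/\delta)}{n\tau^3}}.$$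
   Context: Let $\Lambda_n=\{(i,j):1\le i<j\le n\}$. Let $\mathbf{J}_1,\dots,\mathbf{J}_K$ be mutually independent and independent of $(X_1,\dots,X_n)$, where each $\mathbf{J}_k$ consists of $M$ distinct pairs drawn uniformly at random without replacement from $\Lambda_n$ (different blocks may share pairs). Define $\widetilde U_{M,\mathbf{J}_k}(h)=\frac1M\sum_{(i,j)\in\mathbf{J}_k}h(X_i,X_j)$ and $\widetilde\theta_{\mathrm{MoIU}}(h)=\mathrm{med}\big(\widetilde U_{M,\mathbf{J}_1}(h),\dots,\widetilde U_{M,\mathbf{J}_K}(h)\big)$, the usual sample median. Variances: $\sigma_1^2(h)=\mathrm{Var}(\mathbb{E}[h(X_1,X_2)\mid X_1])$, $\sigma^2(h)=\mathrm{Var}(h(X_1,X_2))$, $\sigma_2^2(h)=\sigma^2(h)-2\sigma_1^2(h)$. *)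

theory Defs
  imports "HOL-Probability.Probability"
begin

definition index_pairs :: "nat \<Rightarrow> (nat \<times> nat) set" where
  "index_pairs n = {(i, j). 1 \<le> i \<and> i < j \<and> j \<le> n}"

text \<open>The possible outcomes of drawing \<open>M\<close> distinct pairs without replacement. The order of the
  draws is forgotten, since the estimator sums over the block; a uniform draw without replacement
  is then the uniform distribution on this finite set.\<close>

definition pair_blocks :: "nat \<Rightarrow> nat \<Rightarrow> (nat \<times> nat) set set" where
  "pair_blocks n M = {B. B \<subseteq> index_pairs n \<and> card B = M}"

definition incomplete_U ::
    "nat \<Rightarrow> ('z \<Rightarrow> 'z \<Rightarrow> real) \<Rightarrow> (nat \<Rightarrow> 'z) \<Rightarrow> (nat \<times> nat) set \<Rightarrow> real" where
  "incomplete_U M h x B = 1 / real M * (\<Sum>(i, j)\<in>B. h (x i) (x j))"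

text \<open>For a sample of even size, the median is the midpoint of the two central order statistics.\<close>

definition sample_median :: "real list \<Rightarrow> real" where
  "sample_median xs =
     (let ys = sort xs; m = length xs div 2
      in if odd (length xs) then ys ! m else (ys ! (m - 1) + ys ! m) / 2)"

definition MoIU ::
    "nat \<Rightarrow> nat \<Rightarrow> ('z \<Rightarrow> 'z \<Rightarrow> real) \<Rightarrow> (nat \<Rightarrow> 'z) \<Rightarrow> (nat \<Rightarrow> (nat \<times> nat) set) \<Rightarrow> real" where
  "MoIU K M h x J = sample_median (map (\<lambda>k. incomplete_U M h x (J k)) [1..<Suc K])"

definition theta :: "'w measure \<Rightarrow> (nat \<Rightarrow> 'w \<Rightarrow> 'z) \<Rightarrow> ('z \<Rightarrow> 'z \<Rightarrow> real) \<Rightarrow> real" where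
  "theta P X h = prob_space.expectation P (\<lambda>\<omega>. h (X 1 \<omega>) (X 2 \<omega>))"

text \<open>The conditioning is on the sigma-algebra generated by \<open>X 1\<close>.\<close>

definition sigma1_sq ::
    "'w measure \<Rightarrow> 'z measure \<Rightarrow> (nat \<Rightarrow> 'w \<Rightarrow> 'z) \<Rightarrow> ('z \<Rightarrow> 'z \<Rightarrow> real) \<Rightarrow> real" where
  "sigma1_sq P Z X h = prob_space.variance P
     (real_cond_exp P (vimage_algebra (space P) (X 1) Z) (\<lambda>\<omega>. h (X 1 \<omega>) (X 2 \<omega>)))"

definition sigma_sq :: "'w measure \<Rightarrow> (nat \<Rightarrow> 'w \<Rightarrow> 'z) \<Rightarrow> ('z \<Rightarrow> 'z \<Rightarrow> real) \<Rightarrow> real" where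
  "sigma_sq P X h = prob_space.variance P (\<lambda>\<omega>. h (X 1 \<omega>) (X 2 \<omega>))"

definition sigma2_sq ::
    "'w measure \<Rightarrow> 'z measure \<Rightarrow> (nat \<Rightarrow> 'w \<Rightarrow> 'z) \<Rightarrow> ('z \<Rightarrow> 'z \<Rightarrow> real) \<Rightarrow> real" where
  "sigma2_sq P Z X h = sigma_sq P X h - 2 * sigma1_sq P Z X h"

end

theory Submission
  imports Defs
begin

text \<open>Let \<open>p\<close> be the fraction of all blocks of \<open>M\<close> pairs whose incomplete U-statistic misses
  \<open>\<theta>\<close> by more than \<open>\<epsilon>\<close>; it is a function of the sample alone. If the median misses, then so do at
  least half of the \<open>K\<close> blocks, which given the sample are independent draws with success probability
  \<open>p\<close>. On \<open>p < \<tau>\<close>, Hoeffding's inequality bounds the probability of this by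
  \<open>exp (- 2 K (1/2 - \<tau>)^2) \<le> \<delta>/2\<close>.

  The event \<open>p \<ge> \<tau>\<close> is handled by Hoeffding's argument for U-statistics. A block touches at most \<open>2 M\<close>
  sample points and \<open>p\<close> is invariant under permutations of the sample, so \<open>p\<close> is an average of
  means of \<open>r = n div (2 M)\<close> independent \<open>{0,1}\<close>-valued variables, and exceeds its mean \<open>q\<close> by
  \<open>t\<close> with probability at most \<open>exp (- 2 r t^2)\<close>. Averaged over blocks, the mean square error of a block is
  at most \<open>\<sigma>^2/M + 4 \<sigma>1^2/(n + 1) \<le> \<tau> \<epsilon>^2/3\<close>, so \<open>q \<le> \<tau>/3\<close> by Markov's inequality,
  and \<open>r \<ge> 9 ln (2/\<delta>)/(8 \<tau>^2)\<close> gives \<open>\<delta>/2\<close> again.\<close>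

section \<open>The sample median\<close>

text \<open>All blocks read the same sample, so their U-statistics are dependent and the count of
  far blocks cannot be handled by Hoeffding's inequality directly. Freezing the sample restores
  independence, but leaves a random success probability \<open>p\<close>. Second moments control
  only the mean of \<open>p\<close>, and Markov's inequality for \<open>p\<close> itself would cost
  a factor \<open>1 / \<delta>\<close>; exponential concentration of \<open>p\<close> is what brings
  in the logarithm. It is available although \<open>h\<close> may be unbounded, because
  \<open>p\<close> averages indicators.

  Constants, with \<open>L = ln (2 / \<delta>)\<close>: the level \<open>\<tau>\<close> is split
  into \<open>\<tau> / 3\<close> for the mean of \<open>p\<close> and \<open>2 \<tau> / 3\<close>
  for its fluctuation. The number \<open>9 L / (8 \<tau>\<^sup>2)\<close> is what makes
  \<open>2 r (2 \<tau> / 3)\<^sup>2 = L\<close>. The size of \<open>M\<close> leaves room for twice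
  as many disjoint copies before rounding, so rounding \<open>r\<close> down is harmless. Rounding
  \<open>M\<close> down at most doubles \<open>1 / M\<close>, which gives
  \<open>9 \<sigma>\<^sup>2 L / (n \<tau>\<^sup>2)\<close>; division by \<open>\<tau> / 3\<close>
  turns the 9 into the 27 of the claim.\<close>

lemma median_deviation_count:
  fixes c \<epsilon> :: real
  assumes "xs \<noteq> []" and dev: "\<bar>sample_median xs - c\<bar> > \<epsilon>"
  shows "length xs \<le> 2 * length (filter (\<lambda>x. \<bar>x - c\<bar> > \<epsilon>) xs)"
proof -
  define ys m where "ys = sort xs" and "m = length xs div 2"
  define S where "S = {i. i < length ys \<and> \<bar>ys ! i - c\<bar> > \<epsilon>}"
  have len: "length ys = length xs" and "sorted ys" by (simp_all add: ys_def)
  then have mono: "i \<le> j \<Longrightarrow> j < length xs \<Longrightarrow> ys ! i \<le> ys ! j" for i j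
    by (simp add: sorted_nth_mono)
  have finS: "finite S" by (simp add: S_def)
  have card_S: "card S = length (filter (\<lambda>x. \<bar>x - c\<bar> > \<epsilon>) xs)"
  proof -
    have "mset (filter (\<lambda>x. \<bar>x - c\<bar> > \<epsilon>) ys) = mset (filter (\<lambda>x. \<bar>x - c\<bar> > \<epsilon>) xs)"
      by (simp add: ys_def)
    then have "length (filter (\<lambda>x. \<bar>x - c\<bar> > \<epsilon>) ys) = length (filter (\<lambda>x. \<bar>x - c\<bar> > \<epsilon>) xs)"
      by (rule mset_eq_length)
    then show ?thesis by (simp add: S_def length_filter_conv_card)
  qed
  have m: "m < length xs" using assms(1) by (simp add: m_def)
  \<comment> \<open>All positions from \<open>m\<close> on inherit the excess. There are
    \<open>length xs - m\<close> of them, at least half for either parity because \<open>m\<close>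
    is rounded down.\<close>
  have upper: "length xs \<le> 2 * card S" if "ys ! m > c + \<epsilon>"
  proof -
    have "{m..<length xs} \<subseteq> S"
    proof
      fix i assume "i \<in> {m..<length xs}"
      with mono[of m i] that show "i \<in> S" by (auto simp: S_def len)
    qed
    from card_mono[OF finS this] show ?thesis by (simp add: m_def)
  qed
  \<comment> \<open>The position \<open>j\<close> stays free: it is \<open>m\<close> for odd length,
    but \<open>m - 1\<close> for even length, where a midpoint below \<open>c - \<epsilon>\<close>
    only forces the smaller central entry down.\<close>
  have lower: "length xs \<le> 2 * card S"
    if "ys ! j < c - \<epsilon>" "j < length xs" "length xs \<le> 2 * Suc j" for j
  proof -
    have "{..j} \<subseteq> S"
    proof
      fix i assume "i \<in> {..j}"
      with mono[of i j] that show "i \<in> S" by (auto simp: S_def len)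
    qed
    from card_mono[OF finS this] that show ?thesis by simp
  qed
  have "length xs \<le> 2 * card S"
  proof (cases "odd (length xs)")
    case True
    then have "sample_median xs = ys ! m"
      by (simp add: sample_median_def Let_def ys_def m_def)
    then have "ys ! m > c + \<epsilon> \<or> ys ! m < c - \<epsilon>" using dev by linarith
    moreover have "length xs \<le> 2 * Suc m" by (simp add: m_def)
    ultimately show ?thesis using upper lower[of m] m by auto
  next
    case False
    then have med: "sample_median xs = (ys ! (m - 1) + ys ! m) / 2"
      by (simp add: sample_median_def Let_def ys_def m_def)
    have m1: "0 < m" "length xs = 2 * m" using False assms(1) by (simp_all add: m_def) (cases xs; fastforce elim!: evenE)
    have le: "ys ! (m - 1) \<le> ys ! m" using mono[of "m - 1" m] m by simp
    consider "(ys ! (m - 1) + ys ! m) / 2 > c + \<epsilon>" | "(ys ! (m - 1) + ys ! m) / 2 < c - \<epsilon>"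
      using dev unfolding med by linarith
    then have "ys ! m > c + \<epsilon> \<or> ys ! (m - 1) < c - \<epsilon>"
      using le by (cases; argo)
    then show ?thesis using upper lower[of "m - 1"] m1 by auto
  qed
  then show ?thesis by (simp add: card_S)
qed

text \<open>Counts are insensitive to sorting, so a condition on an order statistic becomes one in
  which \<open>sort\<close> no longer occurs. This is the route to measurability.\<close>

lemma sort_nth_le_iff:
  fixes c :: "'a :: linorder"
  assumes "m < length xs"
  shows "sort xs ! m \<le> c \<longleftrightarrow> m < length (filter (\<lambda>x. x \<le> c) xs)"
proof -
  define ys where "ys = sort xs"
  define S where "S = {i. i < length ys \<and> ys ! i \<le> c}"
  have len: "length ys = length xs" and "sorted ys" by (simp_all add: ys_def)
  then have mono: "i \<le> j \<Longrightarrow> j < length xs \<Longrightarrow> ys ! i \<le> ys ! j" for i j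
    by (simp add: sorted_nth_mono)
  have "mset (filter (\<lambda>x. x \<le> c) ys) = mset (filter (\<lambda>x. x \<le> c) xs)"
    by (simp add: ys_def)
  then have "length (filter (\<lambda>x. x \<le> c) ys) = length (filter (\<lambda>x. x \<le> c) xs)"
    by (rule mset_eq_length)
  then have card_S: "length (filter (\<lambda>x. x \<le> c) xs) = card S"
    by (simp add: S_def length_filter_conv_card)
  have "ys ! m \<le> c \<longleftrightarrow> m < card S"
  proof
    assume "ys ! m \<le> c"
    have "{..m} \<subseteq> S"
    proof
      fix i assume "i \<in> {..m}"
      with mono[of i m] \<open>ys ! m \<le> c\<close> assms show "i \<in> S" by (auto simp: S_def len)
    qed
    from card_mono[OF _ this] show "m < card S" by (simp add: S_def)
  next
    assume "m < card S"
    show "ys ! m \<le> c"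
    proof (rule ccontr)
      assume "\<not> ys ! m \<le> c"
      have "S \<subseteq> {..<m}"
      proof
        fix i assume "i \<in> S"
        then have "i < length xs" "ys ! i \<le> c" by (auto simp: S_def len)
        with mono[of m i] \<open>\<not> ys ! m \<le> c\<close> show "i \<in> {..<m}" by (meson lessThan_iff not_le order_trans)
      qed
      from card_mono[OF _ this] \<open>m < card S\<close> show False by simp
    qed
  qed
  then show ?thesis by (simp add: card_S ys_def)
qed

text \<open>The sublevel sets of an order statistic are conditions on a finite sum of indicators,
  hence measurable; the median combines at most two order statistics at fixed positions.\<close>

lemma borel_measurable_sample_median:
  assumes "\<And>f. f \<in> set fs \<Longrightarrow> f \<in> borel_measurable N"
  shows "(\<lambda>x. sample_median (map (\<lambda>f. f x) fs)) \<in> borel_measurable N"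
proof -
  have nth: "(\<lambda>x. sort (map (\<lambda>f. f x) fs) ! m) \<in> borel_measurable N" if "m < length fs" for m
    unfolding borel_measurable_iff_le
  proof
    fix c :: real
    have [measurable]: "fs ! i \<in> borel_measurable N" if "i < length fs" for i
      using assms that by simp
    have "sort (map (\<lambda>f. f x) fs) ! m \<le> c
        \<longleftrightarrow> real m < (\<Sum>i<length fs. if (fs ! i) x \<le> c then 1 else 0)" for x
    proof -
      have "real (length (filter (\<lambda>y. y \<le> c) (map (\<lambda>f. f x) fs)))
          = (\<Sum>i<length fs. if (fs ! i) x \<le> c then 1 else 0)"
        by (simp add: length_filter_conv_card sum.If_cases Int_def cong: conj_cong)
      then show ?thesis using sort_nth_le_iff[of m "map (\<lambda>f. f x) fs" c] that
        by (metis length_map of_nat_less_iff)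
    qed
    then have "{x \<in> space N. sort (map (\<lambda>f. f x) fs) ! m \<le> c}
        = {x \<in> space N. real m < (\<Sum>i<length fs. if (fs ! i) x \<le> c then 1 else 0)}"
      by simp
    also have "\<dots> \<in> sets N" by measurable
    finally show "{x \<in> space N. sort (map (\<lambda>f. f x) fs) ! m \<le> c} \<in> sets N" .
  qed
  show ?thesis
  proof (cases "fs = []")
    case False
    then have [measurable]:
        "(\<lambda>x. sort (map (\<lambda>f. f x) fs) ! (length fs div 2 - 1)) \<in> borel_measurable N"
        "(\<lambda>x. sort (map (\<lambda>f. f x) fs) ! (length fs div 2)) \<in> borel_measurable N"
      by (intro nth; cases fs; simp)+
    show ?thesis unfolding sample_median_def Let_def length_map by measurable
  \<comment> \<open>For the empty list the median is a constant, whatever value indexing past the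
    end has.\<close>
  qed (simp add: sample_median_def)
qed

section \<open>Averages over permutations of an i.i.d. sample\<close>

text \<open>Hoeffding's lemma, moved from the extended nonnegative integral to the real one, where
  expectations of independent factors are multiplied.\<close>

lemma (in prob_space) expectation_exp_centered_le:
  fixes f :: "'a \<Rightarrow> real"
  assumes [measurable]: "f \<in> borel_measurable M"
    and bounds: "\<And>\<omega>. \<omega> \<in> space M \<Longrightarrow> f \<omega> \<in> {a..b}" and "0 < l"
  shows "expectation (\<lambda>\<omega>. exp (l * (f \<omega> - expectation f))) \<le> exp (l\<^sup>2 * (b - a)\<^sup>2 / 8)"
proof -
  interpret interval_bounded_random_variable M f a b
    by unfold_locales (use bounds in auto)
  have "integrable M (\<lambda>\<omega>. exp (l * (f \<omega> - expectation f)))"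
    by (rule integrable_const_bound[where B = "exp (l * (b - expectation f))"])
      (use bounds \<open>0 < l\<close> in auto)
  then have "ennreal (expectation (\<lambda>\<omega>. exp (l * (f \<omega> - expectation f))))
      = (\<integral>\<^sup>+\<omega>. exp (l * (f \<omega> - expectation f)) \<partial>M)"
    by (subst nn_integral_eq_integral) auto
  also have "\<dots> \<le> ennreal (exp (l\<^sup>2 * (b - a)\<^sup>2 / 8))"
    using Hoeffdings_lemma_nn_integral[OF \<open>0 < l\<close>] by (simp add: algebra_simps)
  finally show ?thesis by simp
qed

text \<open>Independence factors the moment generating function. Each factor has argument
  \<open>s / r\<close> and costs at most \<open>(s / r)\<^sup>2 / 8\<close> in the exponent, so
  averaging \<open>r\<close> copies gains a factor \<open>r\<close> over a single one.\<close>

lemma (in prob_space) expectation_exp_indep_average_le: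
  fixes Y :: "nat \<Rightarrow> 'a \<Rightarrow> real"
  assumes indep: "indep_vars (\<lambda>_. borel) Y {..<r}" and "0 < r" "0 < s"
    and bounds: "\<And>k \<omega>. k < r \<Longrightarrow> \<omega> \<in> space M \<Longrightarrow> Y k \<omega> \<in> {0..1}"
    and mean: "\<And>k. k < r \<Longrightarrow> expectation (Y k) = m"
  shows "expectation (\<lambda>\<omega>. exp (s * ((\<Sum>k<r. Y k \<omega>) / real r - m))) \<le> exp (s\<^sup>2 / (8 * real r))"
proof -
  have [measurable]: "Y k \<in> borel_measurable M" if "k < r" for k
    using indep that by (auto simp: indep_vars_def)
  define l where "l = s / real r"
  have "0 < l" using \<open>0 < r\<close> \<open>0 < s\<close> by (simp add: l_def)
  have "exp (s * ((\<Sum>k<r. Y k \<omega>) / real r - m)) = (\<Prod>k<r. exp (l * (Y k \<omega> - m)))" for \<omega>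
  proof -
    have "s * ((\<Sum>k<r. Y k \<omega>) / real r - m) = (\<Sum>k<r. l * (Y k \<omega> - m))"
      using \<open>0 < r\<close> by (simp add: l_def right_diff_distrib sum_subtractf sum_distrib_left sum_divide_distrib)
    then show ?thesis by (simp add: exp_sum)
  qed
  then have "expectation (\<lambda>\<omega>. exp (s * ((\<Sum>k<r. Y k \<omega>) / real r - m)))
      = expectation (\<lambda>\<omega>. \<Prod>k<r. exp (l * (Y k \<omega> - m)))" by simp
  also have "\<dots> = (\<Prod>k<r. expectation (\<lambda>\<omega>. exp (l * (Y k \<omega> - m))))"
  proof (rule indep_vars_lebesgue_integral)
    show "indep_vars (\<lambda>_. borel) (\<lambda>k \<omega>. exp (l * (Y k \<omega> - m))) {..<r}"
      by (rule indep_vars_compose2[OF indep]) measurable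
    show "integrable M (\<lambda>\<omega>. exp (l * (Y k \<omega> - m)))" if "k \<in> {..<r}" for k
      by (rule integrable_const_bound[where B = "exp (l * (1 - m))"])
        (use bounds \<open>0 < l\<close> that in auto)
  qed simp
  also have "\<dots> \<le> (\<Prod>k<r. exp (l\<^sup>2 / 8))"
  proof (rule prod_mono, safe)
    fix k assume k: "k < r"
    show "expectation (\<lambda>\<omega>. exp (l * (Y k \<omega> - m))) \<le> exp (l\<^sup>2 / 8)"
      using expectation_exp_centered_le[of "Y k" 0 1 l] bounds k \<open>0 < l\<close> mean by simp
  qed simp
  also have "\<dots> = exp (s\<^sup>2 / (8 * real r))"
  proof -
    have "real r * (l\<^sup>2 / 8) = s\<^sup>2 / (8 * real r)"
      using \<open>0 < r\<close> by (simp add: l_def power2_eq_square)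
    then show ?thesis by (metis exp_of_nat_mult prod_constant card_lessThan)
  qed
  finally show ?thesis .
qed

text \<open>Injectivity makes the singletons of the \<open>\<sigma> j\<close> disjoint, so the
  restrictions of the family to them are independent; evaluation recovers the variables.\<close>

lemma (in prob_space) indep_vars_reindex:
  assumes indep: "indep_vars (\<lambda>_. N) X I" and "inj_on \<sigma> A" "\<sigma> ` A \<subseteq> I"
  shows "indep_vars (\<lambda>_. N) (\<lambda>i. X (\<sigma> i)) A"
proof -
  have "indep_vars (\<lambda>j. Pi\<^sub>M {\<sigma> j} (\<lambda>_. N)) (\<lambda>j \<omega>. restrict (\<lambda>i. X i \<omega>) {\<sigma> j}) A"
    by (rule indep_vars_restrict[OF indep])
      (use assms(2,3) in \<open>auto simp: disjoint_family_on_def inj_on_def\<close>)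
  then have "indep_vars (\<lambda>_. N) (\<lambda>j \<omega>. (\<lambda>f. f (\<sigma> j)) (restrict (\<lambda>i. X i \<omega>) {\<sigma> j})) A"
    by (rule indep_vars_compose2) simp
  then show ?thesis by simp
qed

text \<open>A product measure is determined by rectangles. The product rule is assumed for events
  because \<open>indep_var\<close> wants both variables to have one value type, whereas here they
  will be one observation and a pair, or the blocks and the sample.\<close>

lemma (in prob_space) distr_Pair_eq_pair_measure:
  assumes [measurable]: "X \<in> measurable M S" "Y \<in> measurable M T"
    and indep: "\<And>A B. A \<in> sets S \<Longrightarrow> B \<in> sets T \<Longrightarrow>
      prob ((X -` A \<inter> space M) \<inter> (Y -` B \<inter> space M)) = prob (X -` A \<inter> space M) * prob (Y -` B \<inter> space M)"
  shows "distr M S X \<Otimes>\<^sub>M distr M T Y = distr M (S \<Otimes>\<^sub>M T) (\<lambda>\<omega>. (X \<omega>, Y \<omega>))"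
proof -
  interpret X: prob_space "distr M S X" by (rule prob_space_distr) simp
  interpret Y: prob_space "distr M T Y" by (rule prob_space_distr) simp
  show ?thesis
  proof (rule pair_measure_eqI)
    show "sigma_finite_measure (distr M S X)" "sigma_finite_measure (distr M T Y)"
      by unfold_locales
  next
    fix A B assume "A \<in> sets (distr M S X)" "B \<in> sets (distr M T Y)"
    then have [measurable]: "A \<in> sets S" "B \<in> sets T" by simp_all
    have "(\<lambda>\<omega>. (X \<omega>, Y \<omega>)) -` (A \<times> B) \<inter> space M = (X -` A \<inter> space M) \<inter> (Y -` B \<inter> space M)"
      by auto
    then show "emeasure (distr M S X) A * emeasure (distr M T Y) B
        = emeasure (distr M (S \<Otimes>\<^sub>M T) (\<lambda>\<omega>. (X \<omega>, Y \<omega>))) (A \<times> B)"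
      using indep[of A B]
      by (simp add: emeasure_distr emeasure_eq_measure ennreal_mult[symmetric])
  qed simp
qed

locale iid_sample = prob_space +
  fixes N :: "'z measure" and X :: "'i \<Rightarrow> 'a \<Rightarrow> 'z" and I :: "'i set"
  assumes finite_I: "finite I"
    and indep: "indep_vars (\<lambda>_. N) X I"
    and ident: "\<And>i j. i \<in> I \<Longrightarrow> j \<in> I \<Longrightarrow> distr M N (X i) = distr M N (X j)"
begin

lemma measurable_X [measurable (raw)]: "i \<in> I \<Longrightarrow> X i \<in> measurable M N"
  using indep by (auto simp: indep_vars_def)

lemma measurable_subsample:
  "\<sigma> ` A \<subseteq> I \<Longrightarrow> (\<lambda>\<omega>. \<lambda>i\<in>A. X (\<sigma> i) \<omega>) \<in> measurable M (Pi\<^sub>M A (\<lambda>_. N))"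
  by (intro measurable_restrict measurable_X) auto

text \<open>By independence the law of a subsample is the product of its marginals, and these all
  agree. The empty index set is split off because the characterisation by product measures is for
  nonempty families.\<close>

lemma distr_subsample:
  assumes "inj_on \<sigma> A" "\<sigma> ` A \<subseteq> I" "inj_on \<rho> A" "\<rho> ` A \<subseteq> I"
  shows "distr M (Pi\<^sub>M A (\<lambda>_. N)) (\<lambda>\<omega>. \<lambda>i\<in>A. X (\<sigma> i) \<omega>)
    = distr M (Pi\<^sub>M A (\<lambda>_. N)) (\<lambda>\<omega>. \<lambda>i\<in>A. X (\<rho> i) \<omega>)"
proof (cases "A = {}")
  case False
  have law: "distr M (Pi\<^sub>M A (\<lambda>_. N)) (\<lambda>\<omega>. \<lambda>i\<in>A. X (\<sigma> i) \<omega>)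
      = (\<Pi>\<^sub>M i\<in>A. distr M N (X (\<sigma> i)))" if "inj_on \<sigma> A" "\<sigma> ` A \<subseteq> I" for \<sigma>
    by (rule indep_vars_iff_distr_eq_PiM'[OF False, THEN iffD1])
      (use indep_vars_reindex[OF indep that] measurable_X that(2) in auto)
  show ?thesis unfolding law[OF assms(1,2)] law[OF assms(3,4)]
    by (rule PiM_cong[OF refl ident]) (use assms(2,4) in auto)
qed (simp add: restrict_def)

lemma expectation_subsample:
  fixes f :: "('j \<Rightarrow> 'z) \<Rightarrow> real"
  assumes "inj_on \<sigma> A" "\<sigma> ` A \<subseteq> I" "inj_on \<rho> A" "\<rho> ` A \<subseteq> I"
    and [measurable]: "f \<in> borel_measurable (Pi\<^sub>M A (\<lambda>_. N))"
  shows "expectation (\<lambda>\<omega>. f (\<lambda>i\<in>A. X (\<sigma> i) \<omega>)) = expectation (\<lambda>\<omega>. f (\<lambda>i\<in>A. X (\<rho> i) \<omega>))"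
proof -
  have "expectation (\<lambda>\<omega>. f (\<lambda>i\<in>A. X (\<sigma> i) \<omega>))
      = integral\<^sup>L (distr M (Pi\<^sub>M A (\<lambda>_. N)) (\<lambda>\<omega>. \<lambda>i\<in>A. X (\<sigma> i) \<omega>)) f"
    using measurable_subsample[OF assms(2)] by (simp add: integral_distr)
  also have "\<dots> = integral\<^sup>L (distr M (Pi\<^sub>M A (\<lambda>_. N)) (\<lambda>\<omega>. \<lambda>i\<in>A. X (\<rho> i) \<omega>)) f"
    by (simp add: distr_subsample[OF assms(1-4)])
  also have "\<dots> = expectation (\<lambda>\<omega>. f (\<lambda>i\<in>A. X (\<rho> i) \<omega>))"
    using measurable_subsample[OF assms(4)] by (simp add: integral_distr)
  finally show ?thesis .
qed

end

section \<open>Disjoint copies of an index set and concentration of permutation averages\<close>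

text \<open>Equal cardinalities give bijections from \<open>V\<close> to \<open>W\<close> and
  between the complements in \<open>I\<close>; glued together and extended by the identity they form
  the permutation.\<close>

lemma obtain_permutation_mapping:
  assumes "finite I" "V \<subseteq> I" "W \<subseteq> I" "card V = card W"
  obtains \<rho> where "\<rho> permutes I" "\<rho> ` V = W"
proof -
  have "finite V" "finite W" using assms finite_subset by blast+
  then obtain f where f: "bij_betw f V W"
    using assms(4) finite_same_card_bij by blast
  have "card (I - V) = card (I - W)"
    using assms \<open>finite V\<close> \<open>finite W\<close> by (simp add: card_Diff_subset)
  then obtain g where g: "bij_betw g (I - V) (I - W)"
    using assms(1) finite_same_card_bij[of "I - V" "I - W"] by auto
  define \<rho> where "\<rho> i = (if i \<in> V then f i else if i \<in> I then g i else i)" for i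
  have "bij_betw \<rho> V W" using f by (rule bij_betw_cong[THEN iffD1, rotated]) (simp add: \<rho>_def)
  moreover have "bij_betw \<rho> (I - V) (I - W)"
    using g by (rule bij_betw_cong[THEN iffD1, rotated]) (simp add: \<rho>_def)
  ultimately have "bij_betw \<rho> (V \<union> (I - V)) (W \<union> (I - W))"
    by (rule bij_betw_combine) auto
  then have "bij_betw \<rho> I I" using assms(2,3) by (simp add: Un_absorb1)
  then have "\<rho> permutes I" by (rule bij_imp_permutes) (use assms(2) in \<open>auto simp: \<rho>_def\<close>)
  moreover have "\<rho> ` V = W" using \<open>bij_betw \<rho> V W\<close> by (simp add: bij_betw_def)
  ultimately show ?thesis by (rule that)
qed

text \<open>Consecutive runs of length \<open>v\<close> in an enumeration of \<open>I\<close>. They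
  will carry the \<open>r\<close> disjoint copies of a block's index set.\<close>

lemma obtain_disjoint_subsets:
  assumes "finite I" "r * v \<le> card I"
  obtains W :: "nat \<Rightarrow> 'a set" where "\<And>k. k < r \<Longrightarrow> W k \<subseteq> I" "\<And>k. k < r \<Longrightarrow> card (W k) = v"
    "disjoint_family_on W {..<r}"
proof -
  obtain f where f: "bij_betw f {0..<card I} I" using ex_bij_betw_nat_finite[OF assms(1)] by blast
  define W where "W k = f ` {k * v..<k * v + v}" for k
  have sub: "{k * v..<k * v + v} \<subseteq> {0..<card I}" if "k < r" for k
  proof -
    have "Suc k * v \<le> r * v" using that by (intro mult_le_mono1) simp
    then show ?thesis using assms(2) by auto
  qed
  show ?thesis
  proof (rule that[of W])
    show "W k \<subseteq> I" if "k < r" for k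
      using sub[OF that] f by (auto simp: W_def bij_betw_def)
    show "card (W k) = v" if "k < r" for k
      using sub[OF that] f unfolding W_def
      by (subst card_image) (auto simp: bij_betw_def intro: inj_on_subset)
    have "W j \<inter> W k = {}" if "j < k" "k < r" for j k
    proof -
      have "Suc j * v \<le> k * v" using that by (intro mult_le_mono1) simp
      then have disj: "{j * v..<j * v + v} \<inter> {k * v..<k * v + v} = {}" by auto
      have "inj_on f ({j * v..<j * v + v} \<union> {k * v..<k * v + v})"
        using f sub[of j] sub[of k] that by (auto simp: bij_betw_def intro: inj_on_subset)
      from inj_on_image_Int[OF this, of "{j * v..<j * v + v}" "{k * v..<k * v + v}"]
      show ?thesis unfolding W_def disj by simp
    qed
    then show "disjoint_family_on W {..<r}"
      unfolding disjoint_family_on_def by (metis Int_commute lessThan_iff linorder_neqE_nat)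
  qed
qed

lemma exp_average_le:
  fixes f :: "'b \<Rightarrow> real"
  assumes "finite S" "S \<noteq> {}" "0 \<le> s"
  shows "exp (s * ((\<Sum>x\<in>S. f x) / card S)) \<le> (\<Sum>x\<in>S. exp (s * f x)) / card S"
proof -
  have "card S > 0" using assms by (simp add: card_gt_0_iff)
  have "exp (s * (\<Sum>x\<in>S. (1 / card S) *\<^sub>R f x)) \<le> (\<Sum>x\<in>S. (1 / card S) * exp (s * f x))"
    by (rule convex_on_sum[OF assms(1,2) convex_on_exp[OF assms(3)]])
      (use \<open>card S > 0\<close> in auto)
  then show ?thesis by (simp add: sum_divide_distrib)
qed

context iid_sample
begin

text \<open>The average of the kernel over all permutations of the sample equals the average, over all
  permutations, of means of \<open>r\<close> independent copies of the kernel; convexity of the exponential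
  then reduces the claim to those means.\<close>

lemma expectation_exp_permutation_average_le:
  fixes g :: "('i \<Rightarrow> 'z) \<Rightarrow> real"
  assumes V: "V \<subseteq> I" "r * card V \<le> card I" and "0 < r" "0 < s"
    and g_meas [measurable]: "g \<in> borel_measurable (Pi\<^sub>M V (\<lambda>_. N))"
    and g_bounds: "\<And>x. x \<in> space (Pi\<^sub>M V (\<lambda>_. N)) \<Longrightarrow> g x \<in> {0..1}"
  shows "expectation (\<lambda>\<omega>. exp (s * ((\<Sum>\<pi> | \<pi> permutes I. g (\<lambda>i\<in>V. X (\<pi> i) \<omega>))
            / card {\<pi>. \<pi> permutes I} - expectation (\<lambda>\<omega>. g (\<lambda>i\<in>V. X i \<omega>)))))
    \<le> exp (s\<^sup>2 / (8 * real r))"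
proof -
  define Q where "Q = {\<pi>. \<pi> permutes I}"
  define Y where "Y \<pi> \<omega> = g (\<lambda>i\<in>V. X (\<pi> i) \<omega>)" for \<pi> :: "'i \<Rightarrow> 'i" and \<omega>
  define m where "m = expectation (\<lambda>\<omega>. g (\<lambda>i\<in>V. X i \<omega>))"
  have finQ: "finite Q" unfolding Q_def using finite_permutations[OF finite_I] .
  have "id \<in> Q" by (simp add: Q_def permutes_id)
  then have cardQ: "card Q > 0" "Q \<noteq> {}" using finQ by (auto simp: card_gt_0_iff)
  obtain W where W: "\<And>k. k < r \<Longrightarrow> W k \<subseteq> I" "\<And>k. k < r \<Longrightarrow> card (W k) = card V"
    and disj: "disjoint_family_on W {..<r}"
    using obtain_disjoint_subsets[OF finite_I V(2)] by blast
  have "\<exists>\<rho>. \<rho> permutes I \<and> \<rho> ` V = W k" if "k < r" for k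
    using obtain_permutation_mapping[OF finite_I V(1) W(1)[OF that]] W(2)[OF that] by metis
  then obtain \<rho> where \<rho>: "\<And>k. k < r \<Longrightarrow> \<rho> k permutes I" "\<And>k. k < r \<Longrightarrow> \<rho> k ` V = W k"
    by metis
  have img: "\<pi> ` V \<subseteq> I" if "\<pi> permutes I" for \<pi>
    using that V(1) permutes_image by blast
  have inj: "inj_on \<pi> V" if "\<pi> permutes I" for \<pi>
    using that permutes_inj_on by blast
  have Y_meas [measurable]: "Y \<pi> \<in> borel_measurable M" if "\<pi> permutes I" for \<pi>
    unfolding Y_def using measurable_compose[OF measurable_subsample[OF img[OF that]] g_meas] .
  have Y_bounds: "Y \<pi> \<omega> \<in> {0..1}" if "\<pi> permutes I" "\<omega> \<in> space M" for \<pi> \<omega>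
    unfolding Y_def by (rule g_bounds)
      (use measurable_space[OF measurable_subsample[OF img[OF that(1)]] that(2)] in simp)
  have Y_mean: "expectation (Y \<pi>) = m" if "\<pi> permutes I" for \<pi>
    unfolding Y_def m_def using expectation_subsample[of \<pi> V "\<lambda>i. i" g] inj[OF that] img[OF that] V(1)
    by simp
  \<comment> \<open>The copies sit on the images under \<open>\<pi>\<close> of the disjoint sets
    \<open>W k\<close>. Each single \<open>T \<pi>\<close> is therefore a mean of independent
    variables, although different \<open>\<pi>\<close> reuse the same data.\<close>
  define T where "T \<pi> \<omega> = (\<Sum>k<r. Y (\<pi> \<circ> \<rho> k) \<omega>) / real r" for \<pi> \<omega>
  \<comment> \<open>For fixed \<open>k\<close>, composing with \<open>\<rho> k\<close> on the right
    only rearranges \<open>Q\<close>. Hence \<open>T\<close> and \<open>Y\<close> have the same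
    average over \<open>Q\<close>.\<close>
  have avg: "(\<Sum>\<pi>\<in>Q. Y \<pi> \<omega>) / card Q - m = (\<Sum>\<pi>\<in>Q. T \<pi> \<omega> - m) / card Q" for \<omega>
  proof -
    have "(\<Sum>\<pi>\<in>Q. Y (\<pi> \<circ> \<rho> k) \<omega>) = (\<Sum>\<pi>\<in>Q. Y \<pi> \<omega>)" if "k < r" for k
      unfolding Q_def by (rule sum_permutations_compose_right[OF \<rho>(1)[OF that], symmetric])
    then have "(\<Sum>k<r. \<Sum>\<pi>\<in>Q. Y (\<pi> \<circ> \<rho> k) \<omega>) = real r * (\<Sum>\<pi>\<in>Q. Y \<pi> \<omega>)"
      by simp
    then have "(\<Sum>\<pi>\<in>Q. T \<pi> \<omega>) = (\<Sum>\<pi>\<in>Q. Y \<pi> \<omega>)"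
      using \<open>0 < r\<close> unfolding T_def sum_divide_distrib[symmetric] by (subst sum.swap) simp
    then show ?thesis using cardQ by (simp add: sum_subtractf diff_divide_distrib)
  qed
  have comp: "\<pi> \<circ> \<rho> k permutes I" if "\<pi> \<in> Q" "k < r" for \<pi> k
    using that \<rho>(1) by (auto simp: Q_def intro: permutes_compose)
  have T_meas [measurable]: "T \<pi> \<in> borel_measurable M" if "\<pi> \<in> Q" for \<pi>
    unfolding T_def using comp[OF that] by measurable
  have T_bound: "T \<pi> \<omega> \<le> 1" if "\<pi> \<in> Q" "\<omega> \<in> space M" for \<pi> \<omega>
  proof -
    have "(\<Sum>k<r. Y (\<pi> \<circ> \<rho> k) \<omega>) \<le> (\<Sum>k<r. 1)"
      by (rule sum_mono) (use Y_bounds comp that in auto)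
    then show ?thesis using \<open>0 < r\<close> by (simp add: T_def)
  qed
  have T_int: "integrable M (\<lambda>\<omega>. exp (s * (T \<pi> \<omega> - m)))" if "\<pi> \<in> Q" for \<pi>
    by (rule integrable_const_bound[where B = "exp (s * (1 - m))"])
      (use T_bound \<open>0 < s\<close> that in auto)
  have T_mgf: "expectation (\<lambda>\<omega>. exp (s * (T \<pi> \<omega> - m))) \<le> exp (s\<^sup>2 / (8 * real r))" if "\<pi> \<in> Q" for \<pi>
    unfolding T_def
  proof (rule expectation_exp_indep_average_le[OF _ \<open>0 < r\<close> \<open>0 < s\<close>])
    have \<pi>: "\<pi> permutes I" using that by (simp add: Q_def)
    have "indep_vars (\<lambda>k. Pi\<^sub>M ((\<pi> \<circ> \<rho> k) ` V) (\<lambda>_. N))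
        (\<lambda>k \<omega>. restrict (\<lambda>i. X i \<omega>) ((\<pi> \<circ> \<rho> k) ` V)) {..<r}"
    proof (rule indep_vars_restrict[OF indep])
      show "(\<pi> \<circ> \<rho> k) ` V \<subseteq> I" if "k \<in> {..<r}" for k
        using img[OF comp[OF \<open>\<pi> \<in> Q\<close>]] that by simp
      have "(\<pi> \<circ> \<rho> k) ` V = \<pi> ` W k" if "k < r" for k
        using \<rho>(2)[OF that] by (metis image_comp)
      then show "disjoint_family_on (\<lambda>k. (\<pi> \<circ> \<rho> k) ` V) {..<r}"
        using disj permutes_inj[OF \<pi>] unfolding disjoint_family_on_def
        by (simp flip: image_Int)
    qed
    then have "indep_vars (\<lambda>_. borel) (\<lambda>k \<omega>. (\<lambda>x. g (\<lambda>i\<in>V. x ((\<pi> \<circ> \<rho> k) i)))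
        (restrict (\<lambda>i. X i \<omega>) ((\<pi> \<circ> \<rho> k) ` V))) {..<r}"
    proof (rule indep_vars_compose2)
      fix k
      have "(\<lambda>x. \<lambda>i\<in>V. x ((\<pi> \<circ> \<rho> k) i))
          \<in> measurable (Pi\<^sub>M ((\<pi> \<circ> \<rho> k) ` V) (\<lambda>_. N)) (Pi\<^sub>M V (\<lambda>_. N))"
        by (rule measurable_restrict) (simp add: measurable_component_singleton)
      from measurable_compose[OF this g_meas]
      show "(\<lambda>x. g (\<lambda>i\<in>V. x ((\<pi> \<circ> \<rho> k) i)))
          \<in> borel_measurable (Pi\<^sub>M ((\<pi> \<circ> \<rho> k) ` V) (\<lambda>_. N))" .
    qed
    then show "indep_vars (\<lambda>_. borel) (\<lambda>k. Y (\<pi> \<circ> \<rho> k)) {..<r}"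
      by (simp add: Y_def[abs_def] cong: restrict_cong)
  next
    show "Y (\<pi> \<circ> \<rho> k) \<omega> \<in> {0..1}" if "k < r" "\<omega> \<in> space M" for k \<omega>
      using Y_bounds[OF comp[OF \<open>\<pi> \<in> Q\<close> that(1)] that(2)] .
    show "expectation (Y (\<pi> \<circ> \<rho> k)) = m" if "k < r" for k
      using Y_mean[OF comp[OF \<open>\<pi> \<in> Q\<close> that]] .
  qed
  have "expectation (\<lambda>\<omega>. exp (s * ((\<Sum>\<pi>\<in>Q. Y \<pi> \<omega>) / card Q - m)))
      \<le> expectation (\<lambda>\<omega>. (\<Sum>\<pi>\<in>Q. exp (s * (T \<pi> \<omega> - m))) / card Q)"
  proof (rule integral_mono')
    show "integrable M (\<lambda>\<omega>. (\<Sum>\<pi>\<in>Q. exp (s * (T \<pi> \<omega> - m))) / card Q)"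
      using T_int by simp
    show "exp (s * ((\<Sum>\<pi>\<in>Q. Y \<pi> \<omega>) / card Q - m)) \<le> (\<Sum>\<pi>\<in>Q. exp (s * (T \<pi> \<omega> - m))) / card Q" for \<omega>
      unfolding avg using exp_average_le[OF finQ cardQ(2), of s "\<lambda>\<pi>. T \<pi> \<omega> - m"] \<open>0 < s\<close> by simp
  qed (simp add: sum_nonneg)
  also have "\<dots> = (\<Sum>\<pi>\<in>Q. expectation (\<lambda>\<omega>. exp (s * (T \<pi> \<omega> - m)))) / card Q"
    using T_int by simp
  also have "\<dots> \<le> (\<Sum>\<pi>\<in>Q. exp (s\<^sup>2 / (8 * real r))) / card Q"
    by (intro divide_right_mono sum_mono T_mgf) simp_all
  also have "\<dots> = exp (s\<^sup>2 / (8 * real r))" using cardQ by simp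
  finally show ?thesis by (simp add: Q_def Y_def m_def)
qed

text \<open>The kernels are centred individually before convexity is applied, so that their means may differ.\<close>

lemma prob_permutation_average_ge_le:
  fixes g :: "'b \<Rightarrow> ('i \<Rightarrow> 'z) \<Rightarrow> real" and V :: "'b \<Rightarrow> 'i set"
  assumes S: "finite S" "S \<noteq> {}" and "0 < r" "0 < \<epsilon>"
    and V: "\<And>b. b \<in> S \<Longrightarrow> V b \<subseteq> I" "\<And>b. b \<in> S \<Longrightarrow> r * card (V b) \<le> card I"
    and g_meas: "\<And>b. b \<in> S \<Longrightarrow> g b \<in> borel_measurable (Pi\<^sub>M (V b) (\<lambda>_. N))"
    and g_bounds: "\<And>b x. b \<in> S \<Longrightarrow> x \<in> space (Pi\<^sub>M (V b) (\<lambda>_. N)) \<Longrightarrow> g b x \<in> {0..1}"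
  defines "p \<equiv> \<lambda>\<omega>. (\<Sum>b\<in>S. (\<Sum>\<pi> | \<pi> permutes I. g b (\<lambda>i\<in>V b. X (\<pi> i) \<omega>))
      / card {\<pi>. \<pi> permutes I}) / card S"
    and "q \<equiv> (\<Sum>b\<in>S. expectation (\<lambda>\<omega>. g b (\<lambda>i\<in>V b. X i \<omega>))) / card S"
  shows "prob {\<omega> \<in> space M. q + \<epsilon> \<le> p \<omega>} \<le> exp (- 2 * real r * \<epsilon>\<^sup>2)"
proof -
  define Q where "Q = {\<pi>. \<pi> permutes I}"
  define A where "A b \<omega> = (\<Sum>\<pi>\<in>Q. g b (\<lambda>i\<in>V b. X (\<pi> i) \<omega>)) / card Q" for b \<omega>
  define m where "m b = expectation (\<lambda>\<omega>. g b (\<lambda>i\<in>V b. X i \<omega>))" for b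
  \<comment> \<open>The minimiser of the Chernoff exponent
    \<open>s\<^sup>2 / (8 r) - s \<epsilon>\<close>, whose minimum is
    \<open>- 2 r \<epsilon>\<^sup>2\<close>.\<close>
  define s where "s = 4 * real r * \<epsilon>"
  have "0 < s" using \<open>0 < r\<close> \<open>0 < \<epsilon>\<close> by (simp add: s_def)
  have finQ: "finite Q" unfolding Q_def using finite_permutations[OF finite_I] .
  have "id \<in> Q" by (simp add: Q_def permutes_id)
  then have cardQ: "card Q > 0" using finQ by (auto simp: card_gt_0_iff)
  have cardS: "card S > 0" using S by (simp add: card_gt_0_iff)
  have img: "\<pi> ` V b \<subseteq> I" if "\<pi> \<in> Q" "b \<in> S" for \<pi> b
    using that V(1)[OF that(2)] permutes_image[of \<pi> I] by (auto simp: Q_def)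
  have A_meas [measurable]: "A b \<in> borel_measurable M" if "b \<in> S" for b
  proof -
    have "(\<lambda>\<omega>. g b (\<lambda>i\<in>V b. X (\<pi> i) \<omega>)) \<in> borel_measurable M" if "\<pi> \<in> Q" for \<pi>
      using measurable_compose[OF measurable_subsample[OF img[OF that \<open>b \<in> S\<close>]] g_meas[OF \<open>b \<in> S\<close>]] .
    then show ?thesis unfolding A_def[abs_def] by measurable
  qed
  have A_bound: "A b \<omega> \<le> 1" if "b \<in> S" "\<omega> \<in> space M" for b \<omega>
  proof -
    have "(\<Sum>\<pi>\<in>Q. g b (\<lambda>i\<in>V b. X (\<pi> i) \<omega>)) \<le> (\<Sum>\<pi>\<in>Q. 1)"
    proof (rule sum_mono)
      fix \<pi> assume "\<pi> \<in> Q"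
      with g_bounds[OF that(1) measurable_space[OF measurable_subsample[OF img[OF _ that(1)]] that(2)]]
      show "g b (\<lambda>i\<in>V b. X (\<pi> i) \<omega>) \<le> 1" by simp
    qed
    then show ?thesis using cardQ by (simp add: A_def)
  qed
  have A_int: "integrable M (\<lambda>\<omega>. exp (s * (A b \<omega> - m b)))" if "b \<in> S" for b
    by (rule integrable_const_bound[where B = "exp (s * (1 - m b))"])
      (use A_bound \<open>0 < s\<close> that in auto)
  have p_eq: "p \<omega> - q = (\<Sum>b\<in>S. A b \<omega> - m b) / card S" for \<omega>
    by (simp add: p_def q_def A_def m_def Q_def sum_subtractf diff_divide_distrib)
  have jensen: "exp (s * (p \<omega> - q)) \<le> (\<Sum>b\<in>S. exp (s * (A b \<omega> - m b))) / card S" for \<omega>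
    unfolding p_eq using exp_average_le[OF S, of s "\<lambda>b. A b \<omega> - m b"] \<open>0 < s\<close> by simp
  have rhs_int: "integrable M (\<lambda>\<omega>. (\<Sum>b\<in>S. exp (s * (A b \<omega> - m b))) / card S)"
    using A_int by simp
  have p_meas [measurable]: "p \<in> borel_measurable M"
  proof -
    have "p = (\<lambda>\<omega>. (\<Sum>b\<in>S. A b \<omega>) / card S)" by (simp add: p_def A_def Q_def)
    then show ?thesis by simp
  qed
  have lhs_int: "integrable M (\<lambda>\<omega>. exp (s * (p \<omega> - q)))"
    by (rule Bochner_Integration.integrable_bound[OF rhs_int])
      (use jensen in \<open>auto simp: sum_nonneg\<close>)
  have mgf: "expectation (\<lambda>\<omega>. exp (s * (A b \<omega> - m b))) \<le> exp (s\<^sup>2 / (8 * real r))" if "b \<in> S" for b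
    unfolding A_def m_def Q_def
    by (rule expectation_exp_permutation_average_le[OF V(1)[OF that] V(2)[OF that] \<open>0 < r\<close> \<open>0 < s\<close>
        g_meas[OF that] g_bounds[OF that]])
  have "expectation (\<lambda>\<omega>. exp (s * (p \<omega> - q)))
      \<le> expectation (\<lambda>\<omega>. (\<Sum>b\<in>S. exp (s * (A b \<omega> - m b))) / card S)"
    by (rule integral_mono[OF lhs_int rhs_int jensen])
  also have "\<dots> = (\<Sum>b\<in>S. expectation (\<lambda>\<omega>. exp (s * (A b \<omega> - m b)))) / card S"
    using A_int by simp
  also have "\<dots> \<le> (\<Sum>b\<in>S. exp (s\<^sup>2 / (8 * real r))) / card S"
    by (intro divide_right_mono sum_mono mgf) simp_all
  also have "\<dots> = exp (s\<^sup>2 / (8 * real r))" using cardS by simp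
  finally have bound: "expectation (\<lambda>\<omega>. exp (s * (p \<omega> - q))) \<le> exp (s\<^sup>2 / (8 * real r))" .
  have "q + \<epsilon> \<le> p \<omega> \<longleftrightarrow> exp (s * \<epsilon>) \<le> exp (s * (p \<omega> - q))" for \<omega>
    using \<open>0 < s\<close> by (simp add: mult_le_cancel_left_pos add.commute le_diff_eq)
  then have "prob {\<omega> \<in> space M. q + \<epsilon> \<le> p \<omega>} = prob {\<omega> \<in> space M. exp (s * \<epsilon>) \<le> exp (s * (p \<omega> - q))}"
    by simp
  also have "\<dots> \<le> expectation (\<lambda>\<omega>. exp (s * (p \<omega> - q))) / exp (s * \<epsilon>)"
    by (rule integral_Markov_inequality_measure[OF lhs_int, of "{}"]) auto
  also have "\<dots> \<le> exp (s\<^sup>2 / (8 * real r)) / exp (s * \<epsilon>)"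
    by (intro divide_right_mono bound) simp
  also have "\<dots> = exp (s\<^sup>2 / (8 * real r) - s * \<epsilon>)" by (simp add: exp_diff)
  also have "s\<^sup>2 / (8 * real r) - s * \<epsilon> = - 2 * real r * \<epsilon>\<^sup>2"
    using \<open>0 < r\<close> by (simp add: s_def power2_eq_square field_simps)
  finally show ?thesis .
qed

subsection \<open>Joint laws and conditional expectations\<close>

lemma indep_var_subsamples:
  assumes "A \<inter> B = {}" "A \<subseteq> I" "B \<subseteq> I"
    and "f \<in> measurable (Pi\<^sub>M A (\<lambda>_. N)) S" "g \<in> measurable (Pi\<^sub>M B (\<lambda>_. N)) S"
  shows "indep_var S (\<lambda>\<omega>. f (\<lambda>i\<in>A. X i \<omega>)) S (\<lambda>\<omega>. g (\<lambda>i\<in>B. X i \<omega>))"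
  using indep_var_compose[OF indep_var_restrict[OF indep assms(1-3)] assms(4,5)]
  unfolding comp_def .

text \<open>The two restricted samples have a common type and are independent there. Events about
  \<open>f\<close> and \<open>g\<close>, whose values may differ in type, are pulled back to
  them.\<close>

lemma distr_disjoint_subsamples:
  assumes "A \<inter> B = {}" "A \<subseteq> I" "B \<subseteq> I"
    and [measurable]: "f \<in> measurable (Pi\<^sub>M A (\<lambda>_. N)) S" "g \<in> measurable (Pi\<^sub>M B (\<lambda>_. N)) T"
  shows "distr M (S \<Otimes>\<^sub>M T) (\<lambda>\<omega>. (f (\<lambda>i\<in>A. X i \<omega>), g (\<lambda>i\<in>B. X i \<omega>)))
    = distr M S (\<lambda>\<omega>. f (\<lambda>i\<in>A. X i \<omega>)) \<Otimes>\<^sub>M distr M T (\<lambda>\<omega>. g (\<lambda>i\<in>B. X i \<omega>))"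
proof (rule distr_Pair_eq_pair_measure[symmetric])
  have [measurable]: "(\<lambda>\<omega>. \<lambda>i\<in>A. X i \<omega>) \<in> measurable M (Pi\<^sub>M A (\<lambda>_. N))"
    "(\<lambda>\<omega>. \<lambda>i\<in>B. X i \<omega>) \<in> measurable M (Pi\<^sub>M B (\<lambda>_. N))"
    using measurable_subsample[of "\<lambda>i. i"] assms(2,3) by auto
  show "(\<lambda>\<omega>. f (\<lambda>i\<in>A. X i \<omega>)) \<in> measurable M S" "(\<lambda>\<omega>. g (\<lambda>i\<in>B. X i \<omega>)) \<in> measurable M T"
    by measurable
  fix C D assume [measurable]: "C \<in> sets S" "D \<in> sets T"
  let ?f = "f -` C \<inter> space (Pi\<^sub>M A (\<lambda>_. N))" and ?g = "g -` D \<inter> space (Pi\<^sub>M B (\<lambda>_. N))"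
  have f: "(\<lambda>\<omega>. f (\<lambda>i\<in>A. X i \<omega>)) -` C \<inter> space M = (\<lambda>\<omega>. \<lambda>i\<in>A. X i \<omega>) -` ?f \<inter> space M"
    using measurable_space[of "\<lambda>\<omega>. \<lambda>i\<in>A. X i \<omega>" M "Pi\<^sub>M A (\<lambda>_. N)"] by auto
  have g: "(\<lambda>\<omega>. g (\<lambda>i\<in>B. X i \<omega>)) -` D \<inter> space M = (\<lambda>\<omega>. \<lambda>i\<in>B. X i \<omega>) -` ?g \<inter> space M"
    using measurable_space[of "\<lambda>\<omega>. \<lambda>i\<in>B. X i \<omega>" M "Pi\<^sub>M B (\<lambda>_. N)"] by auto
  have "?f \<in> sets (Pi\<^sub>M A (\<lambda>_. N))" "?g \<in> sets (Pi\<^sub>M B (\<lambda>_. N))" by measurable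
  note indep_varD[OF indep_var_restrict[OF indep assms(1-3)] this]
  moreover have "(\<lambda>\<omega>. (\<lambda>i\<in>A. X i \<omega>, \<lambda>i\<in>B. X i \<omega>)) -` (?f \<times> ?g) \<inter> space M
      = ((\<lambda>\<omega>. \<lambda>i\<in>A. X i \<omega>) -` ?f \<inter> space M) \<inter> ((\<lambda>\<omega>. \<lambda>i\<in>B. X i \<omega>) -` ?g \<inter> space M)" by auto
  ultimately show "prob (((\<lambda>\<omega>. f (\<lambda>i\<in>A. X i \<omega>)) -` C \<inter> space M)
        \<inter> ((\<lambda>\<omega>. g (\<lambda>i\<in>B. X i \<omega>)) -` D \<inter> space M))
      = prob ((\<lambda>\<omega>. f (\<lambda>i\<in>A. X i \<omega>)) -` C \<inter> space M)
        * prob ((\<lambda>\<omega>. g (\<lambda>i\<in>B. X i \<omega>)) -` D \<inter> space M)"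
    unfolding f g by simp
qed

lemma distr_pair:
  assumes "i \<in> I" "j \<in> I" "i \<noteq> j"
  shows "distr M (N \<Otimes>\<^sub>M N) (\<lambda>\<omega>. (X i \<omega>, X j \<omega>)) = distr M N (X i) \<Otimes>\<^sub>M distr M N (X i)"
proof -
  have "distr M (N \<Otimes>\<^sub>M N) (\<lambda>\<omega>. ((\<lambda>f. f i) (\<lambda>k\<in>{i}. X k \<omega>), (\<lambda>f. f j) (\<lambda>k\<in>{j}. X k \<omega>)))
      = distr M N (\<lambda>\<omega>. (\<lambda>f. f i) (\<lambda>k\<in>{i}. X k \<omega>)) \<Otimes>\<^sub>M distr M N (\<lambda>\<omega>. (\<lambda>f. f j) (\<lambda>k\<in>{j}. X k \<omega>))"
    by (rule distr_disjoint_subsamples) (use assms in auto)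
  then show ?thesis using ident[OF assms(1,2)] by simp
qed

lemma distr_triple:
  assumes "i \<in> I" "j \<in> I" "k \<in> I" "i \<noteq> j" "i \<noteq> k" "j \<noteq> k"
  shows "distr M (N \<Otimes>\<^sub>M (N \<Otimes>\<^sub>M N)) (\<lambda>\<omega>. (X i \<omega>, X j \<omega>, X k \<omega>))
    = distr M N (X i) \<Otimes>\<^sub>M (distr M N (X i) \<Otimes>\<^sub>M distr M N (X i))"
proof -
  have "distr M (N \<Otimes>\<^sub>M (N \<Otimes>\<^sub>M N))
        (\<lambda>\<omega>. ((\<lambda>f. f i) (\<lambda>l\<in>{i}. X l \<omega>), (\<lambda>f. (f j, f k)) (\<lambda>l\<in>{j, k}. X l \<omega>)))
      = distr M N (\<lambda>\<omega>. (\<lambda>f. f i) (\<lambda>l\<in>{i}. X l \<omega>))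
        \<Otimes>\<^sub>M distr M (N \<Otimes>\<^sub>M N) (\<lambda>\<omega>. (\<lambda>f. (f j, f k)) (\<lambda>l\<in>{j, k}. X l \<omega>))"
    by (rule distr_disjoint_subsamples) (use assms in auto)
  then show ?thesis using distr_pair[of j k] ident[OF assms(1,2)] assms by simp
qed

text \<open>The events generated by \<open>X i\<close> are the preimages of sets \<open>B\<close>.
  Integrated over such an event, both candidates become the integral of
  \<open>indicator B x * f x y\<close> over the product law, by Fubini. This makes the conditional
  expectation in \<open>sigma1_sq\<close> computable.\<close>

lemma real_cond_exp_pair:
  assumes "i \<in> I" "j \<in> I" "i \<noteq> j"
    and f [measurable]: "(\<lambda>(x, y). f x y) \<in> borel_measurable (N \<Otimes>\<^sub>M N)"
    and int: "integrable M (\<lambda>\<omega>. f (X i \<omega>) (X j \<omega>))"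
  defines "g \<equiv> \<lambda>x. \<integral>y. f x y \<partial>distr M N (X i)"
  shows "AE \<omega> in M. real_cond_exp M (vimage_algebra (space M) (X i) N) (\<lambda>\<omega>. f (X i \<omega>) (X j \<omega>)) \<omega>
      = g (X i \<omega>)"
    and "integrable M (\<lambda>\<omega>. g (X i \<omega>))"
proof -
  define \<mu> where "\<mu> = distr M N (X i)"
  have X_meas [measurable]: "X i \<in> measurable M N" "X j \<in> measurable M N"
    using assms(1,2) measurable_X by auto
  interpret \<mu>: prob_space \<mu> unfolding \<mu>_def by (rule prob_space_distr) simp
  interpret \<mu>2: pair_prob_space \<mu> \<mu> ..
  have sets_\<mu> [measurable_cong]: "sets \<mu> = sets N" by (simp add: \<mu>_def)
  have pair: "distr M (N \<Otimes>\<^sub>M N) (\<lambda>\<omega>. (X i \<omega>, X j \<omega>)) = \<mu> \<Otimes>\<^sub>M \<mu>"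
    unfolding \<mu>_def by (rule distr_pair[OF assms(1-3)])
  have g_meas [measurable]: "g \<in> borel_measurable N"
    unfolding g_def \<mu>_def[symmetric] by measurable
  have int2: "integrable (\<mu> \<Otimes>\<^sub>M \<mu>) (\<lambda>(x, y). f x y)"
    unfolding pair[symmetric] by (subst integrable_distr_eq) (use int in auto)
  have "integrable \<mu> (\<lambda>x. \<integral>y. (\<lambda>(x, y). f x y) (x, y) \<partial>\<mu>)"
    by (rule \<mu>2.integrable_fst'[OF int2])
  then have "integrable \<mu> g" by (simp add: g_def \<mu>_def)
  then show g_int: "integrable M (\<lambda>\<omega>. g (X i \<omega>))"
    unfolding \<mu>_def by (subst (asm) integrable_distr_eq) auto
  define F where "F = vimage_algebra (space M) (X i) N"
  have space_X: "X i \<in> space M \<rightarrow> space N" using X_meas(1) by (auto simp: measurable_def)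
  have subalg: "subalgebra M F"
    unfolding subalgebra_def F_def
    by (auto simp: sets_vimage_algebra2[OF space_X] intro: measurable_sets[OF X_meas(1)])
  interpret finite_measure_subalgebra M F by unfold_locales (rule subalg)
  have "AE \<omega> in M. real_cond_exp M F (\<lambda>\<omega>. f (X i \<omega>) (X j \<omega>)) \<omega> = g (X i \<omega>)"
  proof (rule real_cond_exp_charact[OF _ int g_int])
    have "X i \<in> measurable F N" unfolding F_def by (rule measurable_vimage_algebra1[OF space_X])
    then show "(\<lambda>\<omega>. g (X i \<omega>)) \<in> borel_measurable F" by measurable
    fix A assume "A \<in> sets F"
    then obtain B where B [measurable]: "B \<in> sets N" and A: "A = X i -` B \<inter> space M"
      by (auto simp: F_def sets_vimage_algebra2[OF space_X])
    have int_B: "integrable (\<mu> \<Otimes>\<^sub>M \<mu>) (\<lambda>(x, y). indicator B x * f x y)"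
    proof (rule Bochner_Integration.integrable_bound[OF int2])
      show "(\<lambda>(x, y). indicator B x * f x y) \<in> borel_measurable (\<mu> \<Otimes>\<^sub>M \<mu>)" by measurable
    qed (auto simp: indicator_def)
    have "(\<integral>\<omega>\<in>A. f (X i \<omega>) (X j \<omega>) \<partial>M) = (\<integral>\<omega>. (\<lambda>(x, y). indicator B x * f x y) (X i \<omega>, X j \<omega>) \<partial>M)"
      unfolding set_lebesgue_integral_def
      by (rule Bochner_Integration.integral_cong) (auto simp: A indicator_def)
    also have "\<dots> = (\<integral>z. (\<lambda>(x, y). indicator B x * f x y) z \<partial>(\<mu> \<Otimes>\<^sub>M \<mu>))"
      unfolding pair[symmetric] by (subst integral_distr) auto
    also have "\<dots> = (\<integral>x. \<integral>y. indicator B x * f x y \<partial>\<mu> \<partial>\<mu>)"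
      using \<mu>2.integral_fst'[OF int_B] by simp
    also have "\<dots> = (\<integral>x. indicator B x * g x \<partial>\<mu>)"
      by (simp add: g_def \<mu>_def)
    also have "\<dots> = (\<integral>\<omega>. indicator B (X i \<omega>) * g (X i \<omega>) \<partial>M)"
      unfolding \<mu>_def by (subst integral_distr) auto
    also have "\<dots> = (\<integral>\<omega>\<in>A. g (X i \<omega>) \<partial>M)"
      unfolding set_lebesgue_integral_def
      by (rule Bochner_Integration.integral_cong) (auto simp: A indicator_def)
    finally show "(\<integral>\<omega>\<in>A. f (X i \<omega>) (X j \<omega>) \<partial>M) = (\<integral>\<omega>\<in>A. g (X i \<omega>) \<partial>M)" .
  qed
  then show "AE \<omega> in M. real_cond_exp M (vimage_algebra (space M) (X i) N)
      (\<lambda>\<omega>. f (X i \<omega>) (X j \<omega>)) \<omega> = g (X i \<omega>)"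
    by (simp add: F_def)
qed

end

text \<open>Once the first coordinate is fixed, the two factors depend on independent coordinates
  and the inner integral is a square. This is how a covariance of two pairs with one common index
  becomes a second moment of the projection.\<close>

lemma (in prob_space) integral_mult_sections:
  fixes k :: "'a \<Rightarrow> 'a \<Rightarrow> real"
  assumes [measurable]: "(\<lambda>(x, y). k x y) \<in> borel_measurable (M \<Otimes>\<^sub>M M)"
    and int: "integrable (M \<Otimes>\<^sub>M (M \<Otimes>\<^sub>M M)) (\<lambda>(x, y, z). k x y * k x z)"
  shows "(\<integral>(x, y, z). k x y * k x z \<partial>(M \<Otimes>\<^sub>M (M \<Otimes>\<^sub>M M))) = (\<integral>x. (\<integral>y. k x y \<partial>M)\<^sup>2 \<partial>M)"
proof -
  interpret MM: pair_prob_space M M ..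
  interpret MMM: pair_prob_space M "M \<Otimes>\<^sub>M M" ..
  have "(\<integral>(x, y, z). k x y * k x z \<partial>(M \<Otimes>\<^sub>M (M \<Otimes>\<^sub>M M)))
      = (\<integral>x. \<integral>p. (\<lambda>(x, y, z). k x y * k x z) (x, p) \<partial>(M \<Otimes>\<^sub>M M) \<partial>M)"
    by (rule MMM.integral_fst'[OF int, symmetric])
  also have "\<dots> = (\<integral>x. (\<integral>y. k x y \<partial>M)\<^sup>2 \<partial>M)"
  proof (rule integral_cong_AE)
    \<comment> \<open>Fubini makes the sections integrable for almost every \<open>x\<close> only,
      so the factorisation is an almost sure statement.\<close>
    have "AE x in M. integrable (M \<Otimes>\<^sub>M M) (\<lambda>p. (\<lambda>(x, y, z). k x y * k x z) (x, p))"
      by (rule MMM.AE_integrable_fst'[OF int])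
    then show "AE x in M. (\<integral>p. (\<lambda>(x, y, z). k x y * k x z) (x, p) \<partial>(M \<Otimes>\<^sub>M M)) = (\<integral>y. k x y \<partial>M)\<^sup>2"
    proof eventually_elim
      case (elim x)
      have "(\<integral>p. (\<lambda>(x, y, z). k x y * k x z) (x, p) \<partial>(M \<Otimes>\<^sub>M M))
          = (\<integral>y. \<integral>z. (\<lambda>p. (\<lambda>(x, y, z). k x y * k x z) (x, p)) (y, z) \<partial>M \<partial>M)"
        by (rule MM.integral_fst'[OF elim, symmetric])
      then show ?case by (simp add: power2_eq_square)
    qed
  qed (use int in \<open>measurable\<close>)
  finally show ?thesis .
qed

section \<open>Mean square error of a random block\<close>

text \<open>Deleting \<open>T\<close> leaves an arbitrary subset of \<open>A - T\<close> with
  \<open>m - card T\<close> elements.\<close>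

lemma card_subsets_containing:
  assumes "finite A" "T \<subseteq> A" "card T \<le> m"
  shows "card {B. B \<subseteq> A \<and> card B = m \<and> T \<subseteq> B} = (card A - card T) choose (m - card T)"
proof -
  have fin: "finite T" "\<And>B. B \<subseteq> A \<Longrightarrow> finite B" using assms finite_subset by blast+
  have "bij_betw (\<lambda>B. B - T) {B. B \<subseteq> A \<and> card B = m \<and> T \<subseteq> B}
      {C. C \<subseteq> A - T \<and> card C = m - card T}"
  proof (rule bij_betw_byWitness[where f' = "\<lambda>C. C \<union> T"])
    show "(\<lambda>B. B - T) ` {B. B \<subseteq> A \<and> card B = m \<and> T \<subseteq> B} \<subseteq> {C. C \<subseteq> A - T \<and> card C = m - card T}"
      using fin by (auto simp: card_Diff_subset)
    show "(\<lambda>C. C \<union> T) ` {C. C \<subseteq> A - T \<and> card C = m - card T} \<subseteq> {B. B \<subseteq> A \<and> card B = m \<and> T \<subseteq> B}"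
    proof safe
      fix C assume C: "C \<subseteq> A - T" "card C = m - card T"
      then have "finite C" "C \<inter> T = {}" using fin(2)[of C] by auto
      then show "card (C \<union> T) = m" using fin(1) C(2) assms(3) by (simp add: card_Un_disjoint)
    qed (use assms in auto)
  qed auto
  then show ?thesis
    using n_subsets[of "A - T" "m - card T"] assms fin(1) bij_betw_same_card
    by (fastforce simp: card_Diff_subset)
qed

text \<open>After exchanging sums, only the inclusion probabilities of sampling without replacement
  matter: \<open>m / N\<close> for one element and \<open>m (m - 1) / (N (N - 1))\<close> for two
  distinct ones, where \<open>N = card A\<close>.\<close>

lemma average_double_sum_subsets:
  fixes c :: "'b \<Rightarrow> 'b \<Rightarrow> real"
  assumes fin: "finite A" and m: "0 < m" "m \<le> card A" and A2: "2 \<le> card A"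
  defines "SS \<equiv> {B. B \<subseteq> A \<and> card B = m}"
  shows "(\<Sum>B\<in>SS. \<Sum>e\<in>B. \<Sum>f\<in>B. c e f) / card SS
    = m / card A * (\<Sum>e\<in>A. c e e)
      + m * (real m - 1) / (card A * (real (card A) - 1)) * (\<Sum>e\<in>A. \<Sum>f\<in>A - {e}. c e f)"
proof -
  define n where "n = card A"
  have card_SS: "card SS = n choose m" unfolding SS_def n_def by (rule n_subsets[OF fin])
  have pos: "0 < card SS" "0 < n" "0 < real n - 1" using m A2 by (auto simp: card_SS n_def)
  have finSS: "finite SS" unfolding SS_def using fin by simp
  have one: "card {B \<in> SS. e \<in> B} = m / n * card SS" if "e \<in> A" for e
  proof -
    have "{B \<in> SS. e \<in> B} = {B. B \<subseteq> A \<and> card B = m \<and> {e} \<subseteq> B}" by (auto simp: SS_def)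
    then have "card {B \<in> SS. e \<in> B} = (n - 1) choose (m - 1)"
      using card_subsets_containing[OF fin, of "{e}" m] that m by (simp add: n_def)
    moreover have "m * (n choose m) = n * ((n - 1) choose (m - 1))"
      by (rule times_binomial_minus1_eq[OF m(1)])
    ultimately have "real m * card SS = real n * card {B \<in> SS. e \<in> B}"
      unfolding card_SS by (metis of_nat_mult)
    then show ?thesis using pos by (simp add: field_simps)
  qed
  have two: "card {B \<in> SS. e \<in> B \<and> f \<in> B} = m * (real m - 1) / (n * (real n - 1)) * card SS"
    if "e \<in> A" "f \<in> A" "e \<noteq> f" for e f
  proof -
    have eq: "{B \<in> SS. e \<in> B \<and> f \<in> B} = {B. B \<subseteq> A \<and> card B = m \<and> {e, f} \<subseteq> B}"
      by (auto simp: SS_def)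
    show ?thesis
    proof (cases "2 \<le> m")
      case True
      then have "card {B \<in> SS. e \<in> B \<and> f \<in> B} = (n - 2) choose (m - 2)"
        unfolding eq using card_subsets_containing[OF fin, of "{e, f}" m] that by (simp add: n_def numeral_2_eq_2)
      moreover have "m * (n choose m) = n * ((n - 1) choose (m - 1))"
        by (rule times_binomial_minus1_eq[OF m(1)])
      moreover have "(m - 1) * ((n - 1) choose (m - 1)) = (n - 1) * ((n - 2) choose (m - 2))"
        using times_binomial_minus1_eq[of "m - 1" "n - 1"] True by (simp add: numeral_2_eq_2)
      ultimately have "(m - 1) * (m * card SS) = n * ((n - 1) * card {B \<in> SS. e \<in> B \<and> f \<in> B})"
        unfolding card_SS by (metis mult.left_commute)
      then have "real (m - 1) * (real m * card SS) = real n * (real (n - 1) * card {B \<in> SS. e \<in> B \<and> f \<in> B})"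
        by (metis of_nat_mult)
      then have "(real m - 1) * (real m * card SS) = real n * ((real n - 1) * card {B \<in> SS. e \<in> B \<and> f \<in> B})"
        using True pos by (simp add: of_nat_diff)
      then show ?thesis using pos by (simp add: field_simps)
    next
      \<comment> \<open>A singleton contains no two distinct elements, and the factor
        \<open>m - 1\<close> vanishes as well. The case is separate because \<open>m - 2\<close>
        would be truncated subtraction.\<close>
      case False
      then have "m = 1" using m by simp
      have "card B \<noteq> m" if "B \<subseteq> A" "{e, f} \<subseteq> B" for B
        using card_mono[OF finite_subset[OF that(1) fin] that(2)] \<open>e \<noteq> f\<close> \<open>m = 1\<close> by simp
      then have empty: "{B \<in> SS. e \<in> B \<and> f \<in> B} = {}" unfolding eq by blast
      show ?thesis unfolding empty using \<open>m = 1\<close> by simp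
    qed
  qed
  have "(\<Sum>B\<in>SS. \<Sum>e\<in>B. \<Sum>f\<in>B. c e f)
      = (\<Sum>B\<in>SS. \<Sum>e\<in>A. \<Sum>f\<in>A. if e \<in> B \<and> f \<in> B then c e f else 0)"
  proof (rule sum.cong[OF refl])
    fix B assume "B \<in> SS"
    then have "A \<inter> B = B" by (auto simp: SS_def)
    have "(\<Sum>e\<in>A. \<Sum>f\<in>A. if e \<in> B \<and> f \<in> B then c e f else 0)
        = (\<Sum>e\<in>A. if e \<in> B then \<Sum>f\<in>A. if f \<in> B then c e f else 0 else 0)"
      by (intro sum.cong) auto
    also have "\<dots> = (\<Sum>e\<in>B. \<Sum>f\<in>B. c e f)"
      using \<open>A \<inter> B = B\<close> fin by (simp add: sum.inter_restrict[symmetric])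
    finally show "(\<Sum>e\<in>B. \<Sum>f\<in>B. c e f)
        = (\<Sum>e\<in>A. \<Sum>f\<in>A. if e \<in> B \<and> f \<in> B then c e f else 0)" ..
  qed
  also have "\<dots> = (\<Sum>e\<in>A. \<Sum>f\<in>A. \<Sum>B\<in>SS. if e \<in> B \<and> f \<in> B then c e f else 0)"
    by (subst sum.swap, intro sum.cong[OF refl], rule sum.swap)
  also have "\<dots> = (\<Sum>e\<in>A. \<Sum>f\<in>A. card {B \<in> SS. e \<in> B \<and> f \<in> B} * c e f)"
    using finSS by (simp add: sum.If_cases Int_def)
  also have "\<dots> = (\<Sum>e\<in>A. m / n * card SS * c e e
      + (\<Sum>f\<in>A - {e}. m * (real m - 1) / (n * (real n - 1)) * card SS * c e f))"
  proof (rule sum.cong[OF refl])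
    fix e assume e: "e \<in> A"
    show "(\<Sum>f\<in>A. card {B \<in> SS. e \<in> B \<and> f \<in> B} * c e f) = m / n * card SS * c e e
      + (\<Sum>f\<in>A - {e}. m * (real m - 1) / (n * (real n - 1)) * card SS * c e f)"
      unfolding sum.remove[OF fin e]
      by (intro arg_cong2[where f = "(+)"] sum.cong) (use e in \<open>auto simp: one two\<close>)
  qed
  also have "\<dots> = card SS * (m / n * (\<Sum>e\<in>A. c e e)
      + m * (real m - 1) / (n * (real n - 1)) * (\<Sum>e\<in>A. \<Sum>f\<in>A - {e}. c e f))"
    by (simp add: sum.distrib sum_distrib_left sum_divide_distrib distrib_left mult_ac)
  finally show ?thesis using pos by (simp add: n_def)
qed

section \<open>Counting index pairs and their neighbours\<close>

lemma finite_index_pairs: "finite (index_pairs n)"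
  by (rule finite_subset[of _ "{1..n} \<times> {1..n}"]) (auto simp: index_pairs_def)

lemma card_index_pairs: "2 * card (index_pairs n) = n * (n - 1)"
proof (induction n)
  case (Suc n)
  have "index_pairs (Suc n) = index_pairs n \<union> {1..n} \<times> {Suc n}"
    by (auto simp: index_pairs_def)
  moreover have "index_pairs n \<inter> {1..n} \<times> {Suc n} = {}" by (auto simp: index_pairs_def)
  ultimately have "card (index_pairs (Suc n)) = card (index_pairs n) + n"
    by (simp add: card_Un_disjoint finite_index_pairs)
  then show ?case using Suc by (cases n) (simp_all add: algebra_simps)
next
  case 0
  have "index_pairs 0 = {}" by (auto simp: index_pairs_def)
  then show ?case by simp
qed

definition endpoints :: "nat \<times> nat \<Rightarrow> nat set" where
  "endpoints e = {fst e, snd e}"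

text \<open>A neighbour of \<open>e\<close> keeps one of its two endpoints and takes its other index
  from the remaining \<open>n - 2\<close>. Sorting that choice by \<open>min\<close> and
  \<open>max\<close> reaches every neighbour.\<close>

lemma card_adjacent_pairs_le:
  assumes "e \<in> index_pairs n"
  shows "card {f \<in> index_pairs n - {e}. endpoints e \<inter> endpoints f \<noteq> {}} \<le> 2 * (n - 2)"
proof -
  obtain i j where e: "e = (i, j)" "1 \<le> i" "i < j" "j \<le> n" using assms by (auto simp: index_pairs_def)
  define R where "R = {1..n} - {i, j}"
  have "{f \<in> index_pairs n - {e}. endpoints e \<inter> endpoints f \<noteq> {}}
      \<subseteq> (\<lambda>(a, k). (min a k, max a k)) ` ({i, j} \<times> R)"
  proof
    fix f assume f: "f \<in> {f \<in> index_pairs n - {e}. endpoints e \<inter> endpoints f \<noteq> {}}"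
    obtain k l where f_eq: "f = (k, l)" by fastforce
    with f have kl: "(k, l) \<in> index_pairs n" "endpoints e \<inter> endpoints (k, l) \<noteq> {}" "(k, l) \<noteq> e"
      by auto
    then have kl': "1 \<le> k" "k < l" "l \<le> n" by (auto simp: index_pairs_def)
    consider "k \<in> {i, j}" "l \<in> R" | "l \<in> {i, j}" "k \<in> R"
      using kl(2,3) kl' e by (auto simp: R_def endpoints_def)
    then show "f \<in> (\<lambda>(a, k). (min a k, max a k)) ` ({i, j} \<times> R)"
    proof cases
      case 1
      then show ?thesis using kl'(2) by (intro image_eqI[of _ _ "(k, l)"]) (auto simp: f_eq)
    next
      case 2
      then show ?thesis using kl'(2) by (intro image_eqI[of _ _ "(l, k)"]) (auto simp: f_eq)
    qed
  qed
  then have "card {f \<in> index_pairs n - {e}. endpoints e \<inter> endpoints f \<noteq> {}} \<le> card ({i, j} \<times> R)"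
    by (rule surj_card_le[rotated]) (simp add: R_def)
  also have "\<dots> = 2 * (n - 2)" using e by (simp add: R_def card_cartesian_product card_Diff_subset)
  finally show ?thesis .
qed

section \<open>Covariances of the centred kernel and the mean square error of a block\<close>

text \<open>Three indices are required so that two different pairs can share exactly one of them; it
  is in such a covariance that \<open>sigma1_sq\<close> appears.\<close>

locale kernel_sample = iid_sample P Z X "{1..n}"
  for P :: "'w measure" and Z :: "'z measure" and X :: "nat \<Rightarrow> 'w \<Rightarrow> 'z" and n :: nat +
  fixes h :: "'z \<Rightarrow> 'z \<Rightarrow> real"
  assumes three_le_n: "3 \<le> n"
    and h_meas [measurable]: "(\<lambda>(x, y). h x y) \<in> borel_measurable (Z \<Otimes>\<^sub>M Z)"
    and h_sym: "\<And>x y. x \<in> space Z \<Longrightarrow> y \<in> space Z \<Longrightarrow> h x y = h y x"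
    and h_square: "integrable P (\<lambda>\<omega>. (h (X 1 \<omega>) (X 2 \<omega>))\<^sup>2)"
begin

definition dev :: "nat \<Rightarrow> nat \<Rightarrow> 'w \<Rightarrow> real" where
  "dev i j \<omega> = h (X i \<omega>) (X j \<omega>) - theta P X h"

lemma dev_meas [measurable]: "i \<in> {1..n} \<Longrightarrow> j \<in> {1..n} \<Longrightarrow> dev i j \<in> borel_measurable P"
  unfolding dev_def[abs_def] using measurable_X[of i] measurable_X[of j] by measurable

lemma dev_sym: "i \<in> {1..n} \<Longrightarrow> j \<in> {1..n} \<Longrightarrow> \<omega> \<in> space P \<Longrightarrow> dev i j \<omega> = dev j i \<omega>"
  unfolding dev_def using h_sym measurable_space[OF measurable_X] by simp

lemma distr_pair_eq:
  assumes "i \<in> {1..n}" "j \<in> {1..n}" "i \<noteq> j"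
  shows "distr P (Z \<Otimes>\<^sub>M Z) (\<lambda>\<omega>. (X i \<omega>, X j \<omega>)) = distr P (Z \<Otimes>\<^sub>M Z) (\<lambda>\<omega>. (X 1 \<omega>, X 2 \<omega>))"
  using distr_pair[OF assms] distr_pair[of 1 2] ident[OF assms(1), of 1] three_le_n by simp

text \<open>All pairs of distinct indices have the same law, which reduces everything about one pair
  to \<open>(X 1, X 2)\<close>, where \<open>theta\<close>, \<open>sigma_sq\<close> and square
  integrability are stated.\<close>

lemma pair_transfer:
  fixes f :: "'z \<times> 'z \<Rightarrow> real"
  assumes ij: "i \<in> {1..n}" "j \<in> {1..n}" "i \<noteq> j" and [measurable]: "f \<in> borel_measurable (Z \<Otimes>\<^sub>M Z)"
  shows "integrable P (\<lambda>\<omega>. f (X i \<omega>, X j \<omega>)) \<longleftrightarrow> integrable P (\<lambda>\<omega>. f (X 1 \<omega>, X 2 \<omega>))"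
    and "expectation (\<lambda>\<omega>. f (X i \<omega>, X j \<omega>)) = expectation (\<lambda>\<omega>. f (X 1 \<omega>, X 2 \<omega>))"
proof -
  have [measurable]: "X i \<in> measurable P Z" "X j \<in> measurable P Z" "X 1 \<in> measurable P Z" "X 2 \<in> measurable P Z"
    using ij three_le_n by (auto intro!: measurable_X)
  show "integrable P (\<lambda>\<omega>. f (X i \<omega>, X j \<omega>)) \<longleftrightarrow> integrable P (\<lambda>\<omega>. f (X 1 \<omega>, X 2 \<omega>))"
    using integrable_distr_eq[of "\<lambda>\<omega>. (X i \<omega>, X j \<omega>)" P "Z \<Otimes>\<^sub>M Z" f]
      integrable_distr_eq[of "\<lambda>\<omega>. (X 1 \<omega>, X 2 \<omega>)" P "Z \<Otimes>\<^sub>M Z" f] distr_pair_eq[OF ij] by (simp del: One_nat_def)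
  show "expectation (\<lambda>\<omega>. f (X i \<omega>, X j \<omega>)) = expectation (\<lambda>\<omega>. f (X 1 \<omega>, X 2 \<omega>))"
    using integral_distr[of "\<lambda>\<omega>. (X i \<omega>, X j \<omega>)" P "Z \<Otimes>\<^sub>M Z" f]
      integral_distr[of "\<lambda>\<omega>. (X 1 \<omega>, X 2 \<omega>)" P "Z \<Otimes>\<^sub>M Z" f] distr_pair_eq[OF ij] by (simp del: One_nat_def)
qed

lemma h_integrable: "integrable P (\<lambda>\<omega>. h (X 1 \<omega>) (X 2 \<omega>))"
proof (rule square_integrable_imp_integrable[OF _ h_square])
  have [measurable]: "X 1 \<in> measurable P Z" "X 2 \<in> measurable P Z"
    using three_le_n by (auto intro!: measurable_X)
  show "(\<lambda>\<omega>. h (X 1 \<omega>) (X 2 \<omega>)) \<in> borel_measurable P" by measurable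
qed

lemma dev_square_integrable:
  assumes "i \<in> {1..n}" "j \<in> {1..n}" "i \<noteq> j"
  shows "integrable P (\<lambda>\<omega>. (dev i j \<omega>)\<^sup>2)"
proof -
  have "integrable P (\<lambda>\<omega>. (dev 1 2 \<omega>)\<^sup>2)"
    using h_integrable h_square by (simp add: dev_def power2_diff)
  then show ?thesis
    using pair_transfer(1)[OF assms, of "\<lambda>(x, y). (h x y - theta P X h)\<^sup>2"] by (simp add: dev_def)
qed

lemma dev_integrable:
  assumes "i \<in> {1..n}" "j \<in> {1..n}" "i \<noteq> j"
  shows "integrable P (dev i j)"
  by (rule square_integrable_imp_integrable[OF dev_meas[OF assms(1,2)] dev_square_integrable[OF assms]])

lemma expectation_dev:
  assumes "i \<in> {1..n}" "j \<in> {1..n}" "i \<noteq> j"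
  shows "expectation (dev i j) = 0"
proof -
  have "expectation (dev 1 2) = 0"
    using h_integrable by (simp add: dev_def[abs_def] theta_def prob_space)
  then show ?thesis
    using pair_transfer(2)[OF assms, of "\<lambda>(x, y). h x y - theta P X h"] by (simp add: dev_def[abs_def])
qed

lemma expectation_dev_square:
  assumes "i \<in> {1..n}" "j \<in> {1..n}" "i \<noteq> j"
  shows "expectation (\<lambda>\<omega>. (dev i j \<omega>)\<^sup>2) = sigma_sq P X h"
  using pair_transfer(2)[OF assms, of "\<lambda>(x, y). (h x y - theta P X h)\<^sup>2"]
  by (simp add: dev_def sigma_sq_def theta_def)

lemma dev_mult_integrable:
  assumes "i \<in> {1..n}" "j \<in> {1..n}" "i \<noteq> j" "k \<in> {1..n}" "l \<in> {1..n}" "k \<noteq> l"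
  shows "integrable P (\<lambda>\<omega>. dev i j \<omega> * dev k l \<omega>)"
proof (rule Bochner_Integration.integrable_bound)
  show "integrable P (\<lambda>\<omega>. (dev i j \<omega>)\<^sup>2 + (dev k l \<omega>)\<^sup>2)"
    using dev_square_integrable assms by simp
  show "(\<lambda>\<omega>. dev i j \<omega> * dev k l \<omega>) \<in> borel_measurable P" using assms by measurable
  have "\<bar>a * b\<bar> \<le> a\<^sup>2 + b\<^sup>2" for a b :: real
    using sum_squares_bound[of "\<bar>a\<bar>" "\<bar>b\<bar>"] mult_nonneg_nonneg[of "\<bar>a\<bar>" "\<bar>b\<bar>"]
    unfolding abs_mult power2_abs by linarith
  then show "AE \<omega> in P. norm (dev i j \<omega> * dev k l \<omega>) \<le> norm ((dev i j \<omega>)\<^sup>2 + (dev k l \<omega>)\<^sup>2)"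
    by simp
qed

lemma expectation_dev_mult_disjoint:
  assumes "i \<in> {1..n}" "j \<in> {1..n}" "i \<noteq> j" "k \<in> {1..n}" "l \<in> {1..n}" "k \<noteq> l" "{i, j} \<inter> {k, l} = {}"
  shows "expectation (\<lambda>\<omega>. dev i j \<omega> * dev k l \<omega>) = 0"
proof -
  have meas: "(\<lambda>f. h (f i) (f j) - theta P X h) \<in> borel_measurable (Pi\<^sub>M {i, j} (\<lambda>_. Z))" for i j :: nat
    by measurable
  have "indep_var borel (\<lambda>\<omega>. (\<lambda>f. h (f i) (f j) - theta P X h) (\<lambda>m\<in>{i, j}. X m \<omega>))
      borel (\<lambda>\<omega>. (\<lambda>f. h (f k) (f l) - theta P X h) (\<lambda>m\<in>{k, l}. X m \<omega>))"
    by (rule indep_var_subsamples[OF _ _ _ meas meas]) (use assms in auto)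
  then have "indep_var borel (dev i j) borel (dev k l)" by (simp add: dev_def[abs_def])
  then have "expectation (\<lambda>\<omega>. dev i j \<omega> * dev k l \<omega>) = expectation (dev i j) * expectation (dev k l)"
    by (rule indep_var_lebesgue_integral)
      (use dev_integrable assms in auto)
  then show ?thesis using expectation_dev assms by simp
qed

text \<open>Given the common observation the two deviations are independent with the same
  conditional mean, so their product has the second moment of that mean as expectation. With
  \<open>g\<close> the projection of the kernel, this is the variance of
  \<open>g (X 1)\<close>.\<close>

lemma expectation_dev_mult_common:
  assumes "i \<in> {1..n}" "j \<in> {1..n}" "k \<in> {1..n}" "i \<noteq> j" "i \<noteq> k" "j \<noteq> k"
  shows "expectation (\<lambda>\<omega>. dev i j \<omega> * dev i k \<omega>) = sigma1_sq P Z X h"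
proof -
  define \<mu> where "\<mu> = distr P Z (X i)"
  define \<theta> where "\<theta> = theta P X h"
  have X_meas [measurable]: "X i \<in> measurable P Z" "X j \<in> measurable P Z" "X k \<in> measurable P Z"
      "X 1 \<in> measurable P Z" "X (Suc 0) \<in> measurable P Z" "X 2 \<in> measurable P Z"
    using assms three_le_n by (auto intro!: measurable_X)
  have one: "1 \<in> {1..n}" "2 \<in> {1..n}" "(1::nat) \<noteq> 2" using three_le_n by auto
  have \<mu>_1: "\<mu> = distr P Z (X 1)" unfolding \<mu>_def by (rule ident[OF assms(1) one(1)])
  interpret \<mu>: prob_space \<mu> unfolding \<mu>_def by (rule prob_space_distr) simp
  have sets_\<mu> [measurable_cong]: "sets \<mu> = sets Z" by (simp add: \<mu>_def)
  interpret \<mu>2: pair_prob_space \<mu> \<mu> ..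
  have triple: "distr P (Z \<Otimes>\<^sub>M (Z \<Otimes>\<^sub>M Z)) (\<lambda>\<omega>. (X i \<omega>, X j \<omega>, X k \<omega>)) = \<mu> \<Otimes>\<^sub>M (\<mu> \<Otimes>\<^sub>M \<mu>)"
    unfolding \<mu>_def by (rule distr_triple[OF assms])
  define F where "F = (\<lambda>(x, y, z). (h x y - \<theta>) * (h x z - \<theta>))"
  have F_meas [measurable]: "F \<in> borel_measurable (Z \<Otimes>\<^sub>M (Z \<Otimes>\<^sub>M Z))" unfolding F_def by measurable
  have "integrable P (\<lambda>\<omega>. F (X i \<omega>, X j \<omega>, X k \<omega>))"
    using dev_mult_integrable[of i j i k] assms by (simp add: F_def dev_def \<theta>_def)
  then have F_int: "integrable (\<mu> \<Otimes>\<^sub>M (\<mu> \<Otimes>\<^sub>M \<mu>)) F"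
    unfolding triple[symmetric] by (subst integrable_distr_eq) auto
  define g where "g x = (\<integral>y. h x y \<partial>\<mu>)" for x
  have g_meas [measurable]: "g \<in> borel_measurable Z" unfolding g_def[abs_def] by measurable
  have h_int: "integrable (\<mu> \<Otimes>\<^sub>M \<mu>) (\<lambda>(x, y). h x y)"
    unfolding \<mu>_1 distr_pair[OF one, symmetric]
    by (subst integrable_distr_eq) (use h_integrable in \<open>auto simp del: One_nat_def\<close>)
  have "expectation (\<lambda>\<omega>. dev i j \<omega> * dev i k \<omega>) = expectation (\<lambda>\<omega>. F (X i \<omega>, X j \<omega>, X k \<omega>))"
    by (simp add: F_def dev_def \<theta>_def)
  also have "\<dots> = integral\<^sup>L (\<mu> \<Otimes>\<^sub>M (\<mu> \<Otimes>\<^sub>M \<mu>)) F"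
    unfolding triple[symmetric] by (subst integral_distr) auto
  also have "\<dots> = (\<integral>x. (\<integral>y. h x y - \<theta> \<partial>\<mu>)\<^sup>2 \<partial>\<mu>)"
    using \<mu>.integral_mult_sections[of "\<lambda>x y. h x y - \<theta>"] F_int by (simp add: F_def)
  also have "\<dots> = (\<integral>x. (g x - \<theta>)\<^sup>2 \<partial>\<mu>)"
  proof (rule integral_cong_AE)
    have "AE x in \<mu>. integrable \<mu> (\<lambda>y. (\<lambda>(x, y). h x y) (x, y))"
      by (rule \<mu>2.AE_integrable_fst'[OF h_int])
    then show "AE x in \<mu>. (\<integral>y. h x y - \<theta> \<partial>\<mu>)\<^sup>2 = (g x - \<theta>)\<^sup>2"
      by eventually_elim (simp add: g_def \<mu>.prob_space)
  qed measurable
  also have "\<dots> = expectation (\<lambda>\<omega>. (g (X 1 \<omega>) - \<theta>)\<^sup>2)"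
    unfolding \<mu>_1 by (subst integral_distr) auto
  also have "\<dots> = sigma1_sq P Z X h"
  proof -
    \<comment> \<open>The conditional expectation in the definition of \<open>sigma1_sq\<close> is
      fixed only almost surely, so it is exchanged for \<open>g (X 1 \<omega>)\<close> under the
      integral, both for the mean and for the variance.\<close>
    define E where "E = real_cond_exp P (vimage_algebra (space P) (X 1) Z) (\<lambda>\<omega>. h (X 1 \<omega>) (X 2 \<omega>))"
    have E: "AE \<omega> in P. E \<omega> = g (X 1 \<omega>)"
      using real_cond_exp_pair(1)[OF one h_meas h_integrable] by (simp add: E_def g_def[abs_def] \<mu>_1)
    have [measurable]: "E \<in> borel_measurable P" by (simp add: E_def)
    have "expectation E = expectation (\<lambda>\<omega>. g (X 1 \<omega>))"
      by (rule integral_cong_AE) (use E in auto)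
    also have "\<dots> = (\<integral>x. g x \<partial>\<mu>)" unfolding \<mu>_1 by (subst integral_distr) auto
    also have "\<dots> = integral\<^sup>L (\<mu> \<Otimes>\<^sub>M \<mu>) (\<lambda>(x, y). h x y)"
      using \<mu>2.integral_fst'[OF h_int] by (simp add: g_def)
    also have "\<dots> = \<theta>"
      unfolding \<mu>_1 distr_pair[OF one, symmetric] by (subst integral_distr) (auto simp: \<theta>_def theta_def)
    finally have mean: "expectation E = \<theta>" .
    have "expectation (\<lambda>\<omega>. (g (X 1 \<omega>) - \<theta>)\<^sup>2) = expectation (\<lambda>\<omega>. (E \<omega> - \<theta>)\<^sup>2)"
      by (rule integral_cong_AE) (use E in auto)
    then show ?thesis unfolding sigma1_sq_def E_def[symmetric] mean .
  qed
  finally show ?thesis .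
qed

lemma sigma1_sq_nonneg: "0 \<le> sigma1_sq P Z X h"
  by (simp add: sigma1_sq_def)

lemma sigma_sq_nonneg: "0 \<le> sigma_sq P X h"
  by (simp add: sigma_sq_def)

text \<open>Read \<open>sigma1_sq\<close> as the expectation of a product of two deviations with a
  common index and apply \<open>2 a b \<le> a\<^sup>2 + b\<^sup>2\<close>.\<close>

lemma sigma1_sq_le_sigma_sq: "sigma1_sq P Z X h \<le> sigma_sq P X h"
proof -
  have I: "1 \<in> {1..n}" "2 \<in> {1..n}" "3 \<in> {1..n}" "(1::nat) \<noteq> 2" "(1::nat) \<noteq> 3" "(2::nat) \<noteq> 3"
    using three_le_n by auto
  have "expectation (\<lambda>\<omega>. dev 1 2 \<omega> * dev 1 3 \<omega>)
      \<le> expectation (\<lambda>\<omega>. ((dev 1 2 \<omega>)\<^sup>2 + (dev 1 3 \<omega>)\<^sup>2) / 2)"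
  proof (rule integral_mono)
    show "dev 1 2 \<omega> * dev 1 3 \<omega> \<le> ((dev 1 2 \<omega>)\<^sup>2 + (dev 1 3 \<omega>)\<^sup>2) / 2" for \<omega>
      using sum_squares_bound[of "dev 1 2 \<omega>" "dev 1 3 \<omega>"] by simp
  qed (use dev_mult_integrable dev_square_integrable I in auto)
  also have "\<dots> = sigma_sq P X h"
    using dev_square_integrable expectation_dev_square I by simp
  finally show ?thesis using expectation_dev_mult_common[OF I] by simp
qed

text \<open>A covariance indeed, since \<open>dev\<close> has mean zero on pairs of distinct
  indices.\<close>

definition cov :: "nat \<times> nat \<Rightarrow> nat \<times> nat \<Rightarrow> real" where
  "cov e f = expectation (\<lambda>\<omega>. dev (fst e) (snd e) \<omega> * dev (fst f) (snd f) \<omega>)"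

text \<open>Because pairs are stored in increasing order, a common index can occupy any of four
  combinations of positions. Symmetry of the kernel moves it to the front in both factors, reducing
  all of them to one covariance.\<close>

lemma cov_index_pairs:
  assumes "e \<in> index_pairs n" "f \<in> index_pairs n"
  shows "cov e f = (if e = f then sigma_sq P X h
    else if endpoints e \<inter> endpoints f = {} then 0 else sigma1_sq P Z X h)"
proof -
  obtain i j k l where e: "e = (i, j)" "1 \<le> i" "i < j" "j \<le> n" and f: "f = (k, l)" "1 \<le> k" "k < l" "l \<le> n"
    using assms by (auto simp: index_pairs_def)
  have common: "expectation (\<lambda>\<omega>. dev i' j' \<omega> * dev k' l' \<omega>) = sigma1_sq P Z X h"
    if "(i', j') = (i, j) \<or> (i', j') = (j, i)" "(k', l') = (k, l) \<or> (k', l') = (l, k)"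
      "i' = k'" "j' \<noteq> l'" for i' j' k' l'
    using expectation_dev_mult_common[of i' j' l'] that e f by auto
  have flip: "expectation (\<lambda>\<omega>. dev i' j' \<omega> * dev k' l' \<omega>) = cov e f"
    if "(i', j') = (i, j) \<or> (i', j') = (j, i)" "(k', l') = (k, l) \<or> (k', l') = (l, k)" for i' j' k' l'
    unfolding cov_def
    by (rule Bochner_Integration.integral_cong) (use that e f dev_sym in auto)
  consider "e = f" | "endpoints e \<inter> endpoints f = {}" "e \<noteq> f"
    | "i = k" "j \<noteq> l" | "i = l" "j \<noteq> k" | "j = k" "i \<noteq> l" | "j = l" "i \<noteq> k"
    using e f by (auto simp: endpoints_def)
  then show ?thesis
  proof cases
    case 1
    have "cov e e = sigma_sq P X h" using expectation_dev_square[of i j] e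
      by (simp add: cov_def power2_eq_square)
    then show ?thesis using 1 by simp
  next
    case 2
    then show ?thesis using expectation_dev_mult_disjoint[of i j k l] e f
      by (simp add: cov_def endpoints_def)
  next
    case 3
    then have "cov e f = sigma1_sq P Z X h" using common[of i j k l] flip[of i j k l] by simp
    then show ?thesis using 3 e f by (simp add: endpoints_def)
  next
    case 4
    then have "cov e f = sigma1_sq P Z X h" using common[of i j l k] flip[of i j l k] by simp
    then show ?thesis using 4 e f by (auto simp: endpoints_def)
  next
    case 5
    then have "cov e f = sigma1_sq P Z X h" using common[of j i k l] flip[of j i k l] by simp
    then show ?thesis using 5 e f by (auto simp: endpoints_def)
  next
    case 6
    then have "cov e f = sigma1_sq P Z X h" using common[of j i l k] flip[of j i l k] by simp
    then show ?thesis using 6 e f by (auto simp: endpoints_def)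
  qed
qed

lemma incomplete_U_deviation:
  assumes "B \<in> pair_blocks n m" "0 < m"
  shows "incomplete_U m h (\<lambda>i. X i \<omega>) B - theta P X h = 1 / real m * (\<Sum>e\<in>B. dev (fst e) (snd e) \<omega>)"
proof -
  have "card B = m" using assms by (simp add: pair_blocks_def)
  then show ?thesis using assms(2)
    by (simp add: incomplete_U_def dev_def sum_subtractf case_prod_beta' field_simps)
qed

lemma block_endpoints:
  assumes "B \<in> pair_blocks n m" "e \<in> B"
  shows "fst e \<in> {1..n}" "snd e \<in> {1..n}" "fst e \<noteq> snd e"
  using assms by (auto simp: pair_blocks_def index_pairs_def)

lemma incomplete_U_mean_square:
  assumes B: "B \<in> pair_blocks n m" and "0 < m"
  shows "integrable P (\<lambda>\<omega>. (incomplete_U m h (\<lambda>i. X i \<omega>) B - theta P X h)\<^sup>2)"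
    and "expectation (\<lambda>\<omega>. (incomplete_U m h (\<lambda>i. X i \<omega>) B - theta P X h)\<^sup>2)
      = 1 / (real m)\<^sup>2 * (\<Sum>e\<in>B. \<Sum>f\<in>B. cov e f)"
proof -
  have eq: "(incomplete_U m h (\<lambda>i. X i \<omega>) B - theta P X h)\<^sup>2
      = 1 / (real m)\<^sup>2 * (\<Sum>e\<in>B. \<Sum>f\<in>B. dev (fst e) (snd e) \<omega> * dev (fst f) (snd f) \<omega>)" for \<omega>
    unfolding incomplete_U_deviation[OF assms] power2_eq_square by (simp add: sum_product)
  have int: "integrable P (\<lambda>\<omega>. dev (fst e) (snd e) \<omega> * dev (fst f) (snd f) \<omega>)" if "e \<in> B" "f \<in> B" for e f
    by (rule dev_mult_integrable) (use block_endpoints[OF B] that in auto)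
  show "integrable P (\<lambda>\<omega>. (incomplete_U m h (\<lambda>i. X i \<omega>) B - theta P X h)\<^sup>2)"
    unfolding eq using int by simp
  show "expectation (\<lambda>\<omega>. (incomplete_U m h (\<lambda>i. X i \<omega>) B - theta P X h)\<^sup>2)
      = 1 / (real m)\<^sup>2 * (\<Sum>e\<in>B. \<Sum>f\<in>B. cov e f)"
    unfolding eq using int by (simp add: cov_def)
qed

text \<open>The diagonal of the double sum contributes \<open>\<sigma>\<^sup>2 / m\<close>. Off the
  diagonal, a second pair drawn from the remaining \<open>N - 1\<close> hits one of the at most
  \<open>2 (n - 2)\<close> neighbours, and each hit contributes \<open>\<sigma>1\<^sup>2\<close>;
  here \<open>N = n (n - 1) / 2\<close>.\<close>

lemma average_mean_square_le:
  assumes m: "0 < m" "m \<le> card (index_pairs n)"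
  shows "(\<Sum>B\<in>pair_blocks n m. expectation (\<lambda>\<omega>. (incomplete_U m h (\<lambda>i. X i \<omega>) B - theta P X h)\<^sup>2))
      / card (pair_blocks n m) \<le> sigma_sq P X h / m + 4 * sigma1_sq P Z X h / (real n + 1)"
proof -
  define s s1 where "s = sigma_sq P X h" and "s1 = sigma1_sq P Z X h"
  define c where "c = card (index_pairs n)"
  have "2 * c = n * (n - 1)" unfolding c_def by (rule card_index_pairs)
  then have "2 * real c = real n * (real n - 1)"
    using three_le_n by (metis of_nat_mult of_nat_numeral of_nat_diff of_nat_1 le_trans one_le_numeral)
  then have c: "real c = real n * (real n - 1) / 2" by simp
  have "3 * 2 \<le> n * (n - 1)" using three_le_n by (intro mult_le_mono) auto
  with \<open>2 * c = n * (n - 1)\<close> have c3: "3 \<le> c" by simp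
  have row: "(\<Sum>f\<in>index_pairs n - {e}. cov e f) \<le> 2 * (real n - 2) * s1" if "e \<in> index_pairs n" for e
  proof -
    have "(\<Sum>f\<in>index_pairs n - {e}. cov e f)
        = (\<Sum>f\<in>index_pairs n - {e}. if endpoints e \<inter> endpoints f \<noteq> {} then s1 else 0)"
      by (rule sum.cong) (use that cov_index_pairs in \<open>auto simp: s1_def\<close>)
    also have "\<dots> = card {f \<in> index_pairs n - {e}. endpoints e \<inter> endpoints f \<noteq> {}} * s1"
      by (simp add: sum.If_cases finite_index_pairs Int_def)
    also have "\<dots> \<le> real (2 * (n - 2)) * s1"
      using card_adjacent_pairs_le[OF that] sigma1_sq_nonneg
      by (intro mult_right_mono) (simp_all only: of_nat_le_iff s1_def)
    finally show ?thesis using three_le_n by (simp add: of_nat_diff)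
  qed
  have "(\<Sum>B\<in>pair_blocks n m. expectation (\<lambda>\<omega>. (incomplete_U m h (\<lambda>i. X i \<omega>) B - theta P X h)\<^sup>2))
      / card (pair_blocks n m)
      = 1 / (real m)\<^sup>2 * ((\<Sum>B\<in>pair_blocks n m. \<Sum>e\<in>B. \<Sum>f\<in>B. cov e f) / card (pair_blocks n m))"
    using incomplete_U_mean_square(2)[OF _ m(1)] by (simp add: sum_distrib_left)
  also have "(\<Sum>B\<in>pair_blocks n m. \<Sum>e\<in>B. \<Sum>f\<in>B. cov e f) / card (pair_blocks n m)
      = m / c * (\<Sum>e\<in>index_pairs n. cov e e)
        + m * (real m - 1) / (c * (real c - 1)) * (\<Sum>e\<in>index_pairs n. \<Sum>f\<in>index_pairs n - {e}. cov e f)"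
    unfolding pair_blocks_def c_def
    by (rule average_double_sum_subsets[OF finite_index_pairs m]) (use c3 in \<open>simp add: c_def\<close>)
  also have "(\<Sum>e\<in>index_pairs n. cov e e) = c * s"
    using cov_index_pairs by (simp add: s_def c_def)
  also have "1 / (real m)\<^sup>2 * (m / c * (c * s)
        + m * (real m - 1) / (c * (real c - 1)) * (\<Sum>e\<in>index_pairs n. \<Sum>f\<in>index_pairs n - {e}. cov e f))
      \<le> 1 / (real m)\<^sup>2 * (m / c * (c * s)
        + m * (real m - 1) / (c * (real c - 1)) * (\<Sum>e\<in>index_pairs n. 2 * (real n - 2) * s1))"
    using m c3 by (intro mult_left_mono add_left_mono sum_mono row) (auto intro!: divide_nonneg_nonneg mult_nonneg_nonneg)
  also have "\<dots> = s / m + (real m - 1) / m * (2 * (real n - 2) * s1 / (real c - 1))"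
    using m c3 by (simp add: c_def[symmetric] power2_eq_square distrib_left)
  also have "2 * (real n - 2) * s1 / (real c - 1) = 4 * s1 / (real n + 1)"
  proof -
    \<comment> \<open>This factorisation cancels \<open>n - 2\<close> and produces the denominator
      \<open>n + 1\<close>.\<close>
    have "real c - 1 = (real n - 2) * (real n + 1) / 2" unfolding c by (simp add: field_simps)
    moreover have "real n - 2 > 0" using three_le_n by simp
    then have "2 * (real n - 2) * s1 / ((real n - 2) * (real n + 1) / 2) = 4 * s1 / (real n + 1)"
      by (simp add: divide_simps)
    ultimately show ?thesis by (simp only:)
  qed
  also have "(real m - 1) / m * (4 * s1 / (real n + 1)) \<le> 1 * (4 * s1 / (real n + 1))"
    using m sigma1_sq_nonneg by (intro mult_right_mono) (auto simp: s1_def)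
  finally show ?thesis by (simp add: s_def s1_def)
qed

end

section \<open>Conditioning on the sample\<close>

text \<open>Integrate the sections of \<open>W\<close> against the law of \<open>Y\<close>: those
  over \<open>G\<close> are bounded by 1, all others by \<open>c\<close>. Independence is phrased by
  generated sigma-algebras, which lets \<open>X\<close> and \<open>Y\<close> differ in type.\<close>

lemma (in prob_space) prob_Pair_le_by_sections:
  assumes X [measurable]: "X \<in> measurable M S" and Y [measurable]: "Y \<in> measurable M T"
    and indep: "indep_set (sets (vimage_algebra (space M) X S)) (sets (vimage_algebra (space M) Y T))"
    and W [measurable]: "W \<in> sets (S \<Otimes>\<^sub>M T)" and G [measurable]: "G \<in> sets T" and "0 \<le> c"
    and sections: "\<And>y. y \<in> space T - G \<Longrightarrow> prob {\<omega> \<in> space M. (X \<omega>, y) \<in> W} \<le> c"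
  shows "prob {\<omega> \<in> space M. (X \<omega>, Y \<omega>) \<in> W} \<le> prob {\<omega> \<in> space M. Y \<omega> \<in> G} + c"
proof -
  interpret X: prob_space "distr M S X" by (rule prob_space_distr) simp
  interpret Y: prob_space "distr M T Y" by (rule prob_space_distr) simp
  interpret XY: pair_prob_space "distr M S X" "distr M T Y" ..
  have pair: "distr M S X \<Otimes>\<^sub>M distr M T Y = distr M (S \<Otimes>\<^sub>M T) (\<lambda>\<omega>. (X \<omega>, Y \<omega>))"
    by (rule distr_Pair_eq_pair_measure[OF X Y], rule indep_setD[OF indep]) (rule in_vimage_algebra; assumption)+
  have "ennreal (prob {\<omega> \<in> space M. (X \<omega>, Y \<omega>) \<in> W}) = emeasure (distr M (S \<Otimes>\<^sub>M T) (\<lambda>\<omega>. (X \<omega>, Y \<omega>))) W"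
    by (subst emeasure_distr) (auto simp: emeasure_eq_measure vimage_def Int_def conj_commute)
  also have "\<dots> = (\<integral>\<^sup>+y. emeasure (distr M S X) ((\<lambda>x. (x, y)) -` W) \<partial>distr M T Y)"
    unfolding pair[symmetric] by (rule XY.emeasure_pair_measure_alt2) simp
  also have "\<dots> \<le> (\<integral>\<^sup>+y. indicator G y + ennreal c \<partial>distr M T Y)"
  proof (rule nn_integral_mono)
    fix y assume "y \<in> space (distr M T Y)"
    then have y: "y \<in> space T" by simp
    have sec: "emeasure (distr M S X) ((\<lambda>x. (x, y)) -` W) = prob {\<omega> \<in> space M. (X \<omega>, y) \<in> W}"
      using sets_Pair2[OF W, of y] measurable_space[OF X]
      by (subst emeasure_distr) (auto simp: emeasure_eq_measure vimage_def Int_def conj_commute)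
    show "emeasure (distr M S X) ((\<lambda>x. (x, y)) -` W) \<le> indicator G y + ennreal c"
    proof (cases "y \<in> G")
      case True
      have "ennreal (prob {\<omega> \<in> space M. (X \<omega>, y) \<in> W}) \<le> 1" by simp
      also have "\<dots> \<le> 1 + ennreal c" by simp
      finally show ?thesis using True unfolding sec by simp
    next
      case False
      then show ?thesis using sections[of y] y \<open>0 \<le> c\<close> unfolding sec by (simp add: ennreal_leI)
    qed
  qed
  also have "\<dots> = emeasure (distr M T Y) G + ennreal c"
    using Y.emeasure_space_1 by (subst nn_integral_add) simp_all
  also have "emeasure (distr M T Y) G = ennreal (prob {\<omega> \<in> space M. Y \<omega> \<in> G})"
    by (subst emeasure_distr) (auto simp: emeasure_eq_measure vimage_def Int_def conj_commute)
  finally show ?thesis using \<open>0 \<le> c\<close> by (simp flip: ennreal_plus)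
qed

text \<open>The number of hits is a sum of independent indicators with mean
  \<open>a = card A / card S\<close>. Reaching \<open>K / 2\<close> means exceeding its expectation
  by \<open>K (1/2 - a)\<close>, which is at least \<open>K (1/2 - t)\<close>.\<close>

lemma (in prob_space) prob_half_uniform_draws_le:
  fixes J :: "nat \<Rightarrow> 'a \<Rightarrow> 'b"
  assumes S: "finite S" "S \<noteq> {}" and A: "A \<subseteq> S" "card A / card S \<le> t" "t < 1 / 2" and "0 < K"
    and indep: "indep_vars (\<lambda>_. count_space S) J {1..K}"
    and unif: "\<And>k. k \<in> {1..K} \<Longrightarrow> distr M (count_space S) (J k) = uniform_count_measure S"
  shows "prob {\<omega> \<in> space M. K \<le> 2 * card {k \<in> {1..K}. J k \<omega> \<in> A}} \<le> exp (- 2 * real K * (1 / 2 - t)\<^sup>2)"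
proof -
  define a where "a = card A / card S"
  have a_le: "a \<le> t" using A by (simp add: a_def)
  define Y where "Y k \<omega> = (indicator A (J k \<omega>) :: real)" for k \<omega>
  have J_meas: "J k \<in> measurable M (count_space S)" if "k \<in> {1..K}" for k
    using indep that by (auto simp: indep_vars_def)
  have indep_Y: "indep_vars (\<lambda>_. borel) Y {1..K}"
    unfolding Y_def[abs_def] by (rule indep_vars_compose2[OF indep]) simp
  have mean: "expectation (Y k) = a" if "k \<in> {1..K}" for k
  proof -
    have "expectation (Y k) = prob (J k -` A \<inter> space M)"
      by (simp add: Y_def[abs_def] indicator_vimage[symmetric])
    also have "\<dots> = measure (distr M (count_space S) (J k)) A"
      using J_meas[OF that] A(1) by (subst measure_distr) auto
    also have "\<dots> = a"
      unfolding unif[OF that] a_def using S A(1) by (simp add: measure_uniform_count_measure)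
    finally show ?thesis .
  qed
  interpret Hoeffding_ineq M "{1..K}" Y "\<lambda>_. 0" "\<lambda>_. 1" "real K * a"
  proof unfold_locales
    show "real K * a \<equiv> \<Sum>k\<in>{1..K}. expectation (Y k)"
      by (rule eq_reflection) (simp add: mean)
  qed (use indep_Y in \<open>auto simp: Y_def\<close>)
  have "K \<le> 2 * card {k \<in> {1..K}. J k \<omega> \<in> A} \<longleftrightarrow> real K * a + real K * (1 / 2 - a) \<le> (\<Sum>k\<in>{1..K}. Y k \<omega>)" for \<omega>
  proof -
    have "(\<Sum>k\<in>{1..K}. Y k \<omega>) = card {k \<in> {1..K}. J k \<omega> \<in> A}"
      by (simp add: Y_def indicator_def sum.If_cases Int_def)
    moreover have "real K * a + real K * (1 / 2 - a) = real K / 2" by (simp add: algebra_simps)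
    ultimately show ?thesis by linarith
  qed
  then have "prob {\<omega> \<in> space M. K \<le> 2 * card {k \<in> {1..K}. J k \<omega> \<in> A}}
      = prob {\<omega> \<in> space M. real K * a + real K * (1 / 2 - a) \<le> (\<Sum>k\<in>{1..K}. Y k \<omega>)}" by simp
  also have "\<dots> \<le> exp (- 2 * (real K * (1 / 2 - a))\<^sup>2 / (\<Sum>k\<in>{1..K}. (1 - 0)\<^sup>2))"
    by (rule Hoeffding_ineq_ge) (use a_le A(3) \<open>0 < K\<close> in \<open>auto intro!: mult_nonneg_nonneg\<close>)
  also have "- 2 * (real K * (1 / 2 - a))\<^sup>2 / (\<Sum>k\<in>{1..K}. (1 - 0)\<^sup>2) = - 2 * real K * (1 / 2 - a)\<^sup>2"
    using \<open>0 < K\<close> by (simp add: power2_eq_square)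
  also have "exp (- 2 * real K * (1 / 2 - a)\<^sup>2) \<le> exp (- 2 * real K * (1 / 2 - t)\<^sup>2)"
  proof -
    have "(1 / 2 - t)\<^sup>2 \<le> (1 / 2 - a)\<^sup>2"
      using a_le A(3) by (intro power_mono) auto
    then have "real K * (1 / 2 - t)\<^sup>2 \<le> real K * (1 / 2 - a)\<^sup>2" by (intro mult_left_mono) auto
    then show ?thesis by simp
  qed
  finally show ?thesis .
qed

text \<open>Pairs are stored in increasing order, so the image of a pair under a permutation is sorted again;
  the symmetry of the kernel makes this harmless.\<close>

definition relabel :: "(nat \<Rightarrow> nat) \<Rightarrow> nat \<times> nat \<Rightarrow> nat \<times> nat" where
  "relabel \<pi> e = (min (\<pi> (fst e)) (\<pi> (snd e)), max (\<pi> (fst e)) (\<pi> (snd e)))"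

lemma bij_betw_relabel:
  assumes \<pi>: "\<pi> permutes {1..n}"
  shows "bij_betw (relabel \<pi>) (index_pairs n) (index_pairs n)"
proof -
  have inj: "inj \<pi>" using \<pi> by (rule permutes_inj)
  have "inj_on (relabel \<pi>) (index_pairs n)"
  proof (rule inj_onI)
    fix e f assume e: "e \<in> index_pairs n" and f: "f \<in> index_pairs n" and eq: "relabel \<pi> e = relabel \<pi> f"
    \<comment> \<open>Sorted pairs coincide only if the underlying unordered pairs do, so two
      matchings of the endpoints are possible; the ordering of \<open>e\<close> and \<open>f\<close>
      excludes the crossed one.\<close>
    then have "(\<pi> (fst e) = \<pi> (fst f) \<and> \<pi> (snd e) = \<pi> (snd f)) \<or> (\<pi> (fst e) = \<pi> (snd f) \<and> \<pi> (snd e) = \<pi> (fst f))"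
      by (auto simp: relabel_def min_def max_def split: if_splits)
    then have "(fst e = fst f \<and> snd e = snd f) \<or> (fst e = snd f \<and> snd e = fst f)"
      by (simp add: inj_eq[OF inj])
    then show "e = f" using e f by (auto simp: index_pairs_def)
  qed
  moreover have "relabel \<pi> ` index_pairs n \<subseteq> index_pairs n"
  proof
    fix f assume "f \<in> relabel \<pi> ` index_pairs n"
    then obtain i j where f: "f = relabel \<pi> (i, j)" and ij: "1 \<le> i" "i < j" "j \<le> n"
      by (auto simp: index_pairs_def)
    have "\<pi> i \<in> {1..n}" "\<pi> j \<in> {1..n}" using ij permutes_in_image[OF \<pi>, of i] permutes_in_image[OF \<pi>, of j] by auto
    moreover have "\<pi> i \<noteq> \<pi> j" using ij by (simp add: inj_eq[OF inj])
    ultimately show "f \<in> index_pairs n" by (auto simp: f relabel_def index_pairs_def min_def max_def)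
  qed
  ultimately show ?thesis
    using endo_inj_surj[OF finite_index_pairs] by (simp add: bij_betw_def)
qed

lemma finite_pair_blocks: "finite (pair_blocks n m)"
  by (rule finite_subset[of _ "Pow (index_pairs n)"]) (auto simp: pair_blocks_def finite_index_pairs)

lemma bij_betw_relabel_blocks:
  assumes \<pi>: "\<pi> permutes {1..n}"
  shows "bij_betw (\<lambda>B. relabel \<pi> ` B) (pair_blocks n m) (pair_blocks n m)"
proof -
  note rel = bij_betw_relabel[OF \<pi>]
  then have inj: "inj_on (relabel \<pi>) (index_pairs n)" by (simp add: bij_betw_def)
  have "inj_on (\<lambda>B. relabel \<pi> ` B) (pair_blocks n m)"
    by (rule inj_onI) (simp add: pair_blocks_def inj_on_image_eq_iff[OF inj])
  moreover have "(\<lambda>B. relabel \<pi> ` B) ` pair_blocks n m \<subseteq> pair_blocks n m"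
    using rel by (auto simp: pair_blocks_def bij_betw_def card_image inj_on_subset[OF inj])
  ultimately show ?thesis
    using endo_inj_surj[OF finite_pair_blocks] by (simp add: bij_betw_def)
qed

lemma incomplete_U_relabel:
  assumes \<pi>: "\<pi> permutes {1..n}" and B: "B \<in> pair_blocks n m"
    and sym: "\<And>i j. i \<in> {1..n} \<Longrightarrow> j \<in> {1..n} \<Longrightarrow> h (y i) (y j) = h (y j) (y i)"
  shows "incomplete_U m h (\<lambda>i. y (\<pi> i)) B = incomplete_U m h y (relabel \<pi> ` B)"
proof -
  have B_sub: "B \<subseteq> index_pairs n" using B by (simp add: pair_blocks_def)
  have inj: "inj_on (relabel \<pi>) B"
    using bij_betw_relabel[OF \<pi>] B_sub by (auto simp: bij_betw_def intro: inj_on_subset)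
  have "h (y (\<pi> (fst e))) (y (\<pi> (snd e))) = h (y (fst (relabel \<pi> e))) (y (snd (relabel \<pi> e)))" if "e \<in> B" for e
  proof -
    have "fst e \<in> {1..n}" "snd e \<in> {1..n}" using that B_sub by (auto simp: index_pairs_def)
    then have "\<pi> (fst e) \<in> {1..n}" "\<pi> (snd e) \<in> {1..n}" using permutes_in_image[OF \<pi>] by blast+
    then show ?thesis using sym[of "\<pi> (fst e)" "\<pi> (snd e)"] by (auto simp: relabel_def min_def max_def)
  qed
  then show ?thesis by (simp add: incomplete_U_def case_prod_beta' sum.reindex[OF inj])
qed

lemma card_Union_endpoints_le:
  assumes "B \<in> pair_blocks n m"
  shows "card (\<Union>e\<in>B. endpoints e) \<le> 2 * m"
proof -
  have fin: "finite B" and m: "card B = m"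
    using assms finite_subset[OF _ finite_index_pairs] by (auto simp: pair_blocks_def)
  have "card (\<Union>e\<in>B. endpoints e) \<le> (\<Sum>e\<in>B. card (endpoints e))" by (rule card_UN_le[OF fin])
  also have "\<dots> \<le> (\<Sum>e\<in>B. 2)" by (rule sum_mono) (simp add: endpoints_def card_insert_le_m1)
  finally show ?thesis by (simp add: m)
qed

lemma incomplete_U_restrict:
  assumes "(\<Union>e\<in>B. endpoints e) \<subseteq> V"
  shows "incomplete_U m h (\<lambda>i\<in>V. y i) B = incomplete_U m h y B"
  unfolding incomplete_U_def
  by (intro arg_cong2[where f = "(*)"] refl sum.cong) (use assms in \<open>auto simp: endpoints_def UN_subset_iff\<close>)

section \<open>Concentration of the fraction of far blocks\<close>

context kernel_sample
begin

definition far :: "nat \<Rightarrow> real \<Rightarrow> (nat \<times> nat) set \<Rightarrow> (nat \<Rightarrow> 'z) \<Rightarrow> bool" where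
  "far m \<epsilon> B y \<longleftrightarrow> \<bar>incomplete_U m h y B - theta P X h\<bar> > \<epsilon>"

text \<open>The conditional probability, given the sample \<open>y\<close>, that one uniformly drawn
  block is far.\<close>

definition far_fraction :: "nat \<Rightarrow> real \<Rightarrow> (nat \<Rightarrow> 'z) \<Rightarrow> real" where
  "far_fraction m \<epsilon> y = (\<Sum>B\<in>pair_blocks n m. of_bool (far m \<epsilon> B y)) / card (pair_blocks n m)"

lemma incomplete_U_meas:
  assumes "(\<Union>e\<in>B. endpoints e) \<subseteq> V"
  shows "(\<lambda>y. incomplete_U m h y B) \<in> borel_measurable (Pi\<^sub>M V (\<lambda>_. Z))"
proof -
  have "(\<lambda>y. h (y (fst e)) (y (snd e))) \<in> borel_measurable (Pi\<^sub>M V (\<lambda>_. Z))" if "e \<in> B" for e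
  proof -
    have [measurable]: "fst e \<in> V" "snd e \<in> V" using assms that by (auto simp: endpoints_def)
    show ?thesis by measurable
  qed
  then show ?thesis unfolding incomplete_U_def case_prod_beta' by measurable
qed

lemma far_meas:
  assumes "(\<Union>e\<in>B. endpoints e) \<subseteq> V"
  shows "Measurable.pred (Pi\<^sub>M V (\<lambda>_. Z)) (far m \<epsilon> B)"
proof -
  note [measurable] = incomplete_U_meas[OF assms]
  show ?thesis unfolding far_def[abs_def] by measurable
qed

lemma endpoints_subset: "B \<in> pair_blocks n m \<Longrightarrow> (\<Union>e\<in>B. endpoints e) \<subseteq> {1..n}"
  by (auto simp: pair_blocks_def index_pairs_def endpoints_def)

lemma far_restrict: "(\<Union>e\<in>B. endpoints e) \<subseteq> V \<Longrightarrow> far m \<epsilon> B (\<lambda>i\<in>V. y i) = far m \<epsilon> B y"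
  by (simp add: far_def incomplete_U_restrict)

text \<open>A permutation of the sample can be moved onto the blocks, where it merely rearranges the
  sum over all of them.\<close>

lemma far_fraction_permute:
  assumes \<pi>: "\<pi> permutes {1..n}" and y: "\<And>i. i \<in> {1..n} \<Longrightarrow> y i \<in> space Z"
  shows "far_fraction m \<epsilon> (\<lambda>i. y (\<pi> i)) = far_fraction m \<epsilon> y"
proof -
  have "(\<Sum>B\<in>pair_blocks n m. of_bool (far m \<epsilon> B (\<lambda>i. y (\<pi> i))))
      = (\<Sum>B\<in>pair_blocks n m. of_bool (far m \<epsilon> (relabel \<pi> ` B) y) :: real)"
    using incomplete_U_relabel[OF \<pi>, of _ m h y] h_sym y by (intro sum.cong) (auto simp: far_def)
  also have "\<dots> = (\<Sum>B\<in>pair_blocks n m. of_bool (far m \<epsilon> B y))"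
    by (rule sum.reindex_bij_betw[OF bij_betw_relabel_blocks[OF \<pi>]])
  finally show ?thesis by (simp add: far_fraction_def)
qed

text \<open>Markov's inequality for the squared error of each block, averaged afterwards. Only the
  average error is under control: a single block may consist of many pairs through one
  index.\<close>

lemma expectation_far_average_le:
  assumes m: "0 < m" "m \<le> card (index_pairs n)" and "0 \<le> \<epsilon>" "0 < \<eta>"
    and bound: "sigma_sq P X h / m + 4 * sigma1_sq P Z X h / (real n + 1) \<le> \<eta> * \<epsilon>\<^sup>2"
  shows "(\<Sum>B\<in>pair_blocks n m. expectation (\<lambda>\<omega>. of_bool (far m \<epsilon> B (\<lambda>i. X i \<omega>)))) / card (pair_blocks n m) \<le> \<eta>"
proof -
  define S where "S = pair_blocks n m"
  define D where "D B \<omega> = (incomplete_U m h (\<lambda>i. X i \<omega>) B - theta P X h)\<^sup>2" for B \<omega>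
  have finS: "finite S" by (simp add: S_def finite_pair_blocks)
  have "card S = card (index_pairs n) choose m"
    unfolding S_def pair_blocks_def by (rule n_subsets[OF finite_index_pairs])
  then have cardS: "0 < card S" using m by simp
  have avg: "(\<Sum>B\<in>S. expectation (D B)) / card S \<le> \<eta> * \<epsilon>\<^sup>2"
    using average_mean_square_le[OF m] bound by (simp add: S_def D_def[abs_def])
  have D_int: "integrable P (D B)" if "B \<in> S" for B
    using incomplete_U_mean_square(1)[of B m] that m by (simp add: S_def D_def[abs_def])
  have far_meas': "Measurable.pred P (\<lambda>\<omega>. far m \<epsilon> B (\<lambda>i. X i \<omega>))" if "B \<in> S" for B
    using measurable_compose[OF measurable_subsample[of "\<lambda>i. i" "{1..n}"]
        far_meas[OF endpoints_subset[of B m], of m \<epsilon>]] that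
    by (simp add: far_restrict endpoints_subset S_def del: One_nat_def)
  have int: "integrable P (\<lambda>\<omega>. of_bool (far m \<epsilon> B (\<lambda>i. X i \<omega>)) :: real)" if "B \<in> S" for B
    by (rule integrable_const_bound[where B = 1]) (use far_meas'[OF that] in auto)
  show ?thesis
  proof (cases "\<epsilon> = 0")
    case False
    then have "0 < \<epsilon>\<^sup>2" by simp
    have le: "\<epsilon>\<^sup>2 * expectation (\<lambda>\<omega>. of_bool (far m \<epsilon> B (\<lambda>i. X i \<omega>))) \<le> expectation (D B)" if "B \<in> S" for B
    proof -
      have "expectation (\<lambda>\<omega>. \<epsilon>\<^sup>2 * of_bool (far m \<epsilon> B (\<lambda>i. X i \<omega>))) \<le> expectation (D B)"
      proof (rule integral_mono)
        fix \<omega>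
        show "\<epsilon>\<^sup>2 * of_bool (far m \<epsilon> B (\<lambda>i. X i \<omega>)) \<le> D B \<omega>"
          using \<open>0 \<le> \<epsilon>\<close> abs_le_square_iff[of \<epsilon> "incomplete_U m h (\<lambda>i. X i \<omega>) B - theta P X h"]
          by (auto simp: D_def far_def)
      qed (use int D_int that in auto)
      then show ?thesis by simp
    qed
    have "\<epsilon>\<^sup>2 * ((\<Sum>B\<in>S. expectation (\<lambda>\<omega>. of_bool (far m \<epsilon> B (\<lambda>i. X i \<omega>)))) / card S)
        = (\<Sum>B\<in>S. \<epsilon>\<^sup>2 * expectation (\<lambda>\<omega>. of_bool (far m \<epsilon> B (\<lambda>i. X i \<omega>)))) / card S"
      by (simp add: sum_distrib_left)
    also have "\<dots> \<le> (\<Sum>B\<in>S. expectation (D B)) / card S"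
      by (intro divide_right_mono sum_mono le) auto
    also have "\<dots> \<le> \<epsilon>\<^sup>2 * \<eta>" using avg by (simp add: mult.commute)
    finally show ?thesis unfolding S_def using \<open>0 < \<epsilon>\<^sup>2\<close> by (rule mult_left_le_imp_le)
  next
    \<comment> \<open>Markov's inequality is void here, but the mean square errors vanish.\<close>
    case True
    have nonneg: "0 \<le> expectation (D B)" for B by (simp add: D_def)
    have "(\<Sum>B\<in>S. expectation (D B)) \<le> 0" using avg True cardS by (simp add: divide_le_0_iff)
    then have zero: "expectation (D B) = 0" if "B \<in> S" for B
      using sum_nonneg_eq_0_iff[OF finS, of "\<lambda>B. expectation (D B)"] nonneg that
      by (meson order_antisym sum_nonneg)
    have "expectation (\<lambda>\<omega>. of_bool (far m \<epsilon> B (\<lambda>i. X i \<omega>))) = 0" if "B \<in> S" for B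
    proof -
      have "AE \<omega> in P. D B \<omega> = 0"
        using integral_nonneg_eq_0_iff_AE[OF D_int[OF that]] zero[OF that] by (simp add: D_def)
      then have "AE \<omega> in P. of_bool (far m \<epsilon> B (\<lambda>i. X i \<omega>)) = (0::real)"
        by eventually_elim (simp add: D_def far_def True)
      then show ?thesis using far_meas'[OF that] by (subst integral_cong_AE[where g = "\<lambda>_. 0"]) auto
    qed
    then have "(\<Sum>B\<in>S. expectation (\<lambda>\<omega>. of_bool (far m \<epsilon> B (\<lambda>i. X i \<omega>)))) = (0::real)"
      by (intro sum.neutral ballI)
    then show ?thesis using \<open>0 < \<eta>\<close> unfolding S_def by simp
  qed
qed

text \<open>Invariance makes \<open>far_fraction\<close> equal to its own average over permutations
  of the sample. Each indicator in it reads at most \<open>2 * m\<close> observations, so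
  \<open>r\<close> disjoint copies fit into the sample.\<close>

lemma prob_far_fraction_ge_le:
  assumes m: "0 < m" "m \<le> card (index_pairs n)" and "0 \<le> \<epsilon>" "0 < \<eta>" "\<eta> < t"
    and bound: "sigma_sq P X h / m + 4 * sigma1_sq P Z X h / (real n + 1) \<le> \<eta> * \<epsilon>\<^sup>2"
    and r: "0 < r" "r * (2 * m) \<le> n"
  shows "prob {\<omega> \<in> space P. t \<le> far_fraction m \<epsilon> (\<lambda>i\<in>{1..n}. X i \<omega>)} \<le> exp (- 2 * real r * (t - \<eta>)\<^sup>2)"
proof -
  define S where "S = pair_blocks n m"
  define V where "V B = (\<Union>e\<in>B. endpoints e)" for B :: "(nat \<times> nat) set"
  define g where "g B y = (of_bool (far m \<epsilon> B y) :: real)" for B y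
  define Q where "Q = {\<pi>. \<pi> permutes {1..n}}"
  define q where "q = (\<Sum>B\<in>S. expectation (\<lambda>\<omega>. g B (\<lambda>i\<in>V B. X i \<omega>))) / card S"
  have finS: "finite S" by (simp add: S_def finite_pair_blocks)
  have "card S = card (index_pairs n) choose m"
    unfolding S_def pair_blocks_def by (rule n_subsets[OF finite_index_pairs])
  then have "0 < card S" using m by simp
  then have S_ne: "S \<noteq> {}" by auto
  have finQ: "finite Q" unfolding Q_def using finite_permutations[of "{1..n}"] by simp
  have "id \<in> Q" by (simp add: Q_def permutes_id)
  then have cardQ: "card Q > 0" using finQ by (auto simp: card_gt_0_iff)
  have g_restrict: "g B (\<lambda>i\<in>V B. y i) = g B y" for B y
    by (simp add: g_def V_def far_restrict)
  have q: "q \<le> \<eta>"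
    using expectation_far_average_le[OF m \<open>0 \<le> \<epsilon>\<close> \<open>0 < \<eta>\<close> bound]
    by (simp add: q_def g_restrict) (simp add: g_def S_def)
  have p: "(\<Sum>B\<in>S. (\<Sum>\<pi>\<in>Q. g B (\<lambda>i\<in>V B. X (\<pi> i) \<omega>)) / card Q) / card S
      = far_fraction m \<epsilon> (\<lambda>i\<in>{1..n}. X i \<omega>)" if "\<omega> \<in> space P" for \<omega>
  proof -
    have X_space: "X i \<omega> \<in> space Z" if "i \<in> {1..n}" for i
      using measurable_space[OF measurable_X[OF that] \<open>\<omega> \<in> space P\<close>] .
    have "(\<Sum>B\<in>S. (\<Sum>\<pi>\<in>Q. g B (\<lambda>i\<in>V B. X (\<pi> i) \<omega>)) / card Q) / card S
        = (\<Sum>\<pi>\<in>Q. (\<Sum>B\<in>S. g B (\<lambda>i. X (\<pi> i) \<omega>)) / card S) / card Q"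
      by (subst sum_divide_distrib[symmetric], subst sum.swap) (simp add: g_restrict sum_divide_distrib mult.commute)
    also have "\<dots> = (\<Sum>\<pi>\<in>Q. far_fraction m \<epsilon> (\<lambda>i. X (\<pi> i) \<omega>)) / card Q"
      by (simp add: far_fraction_def g_def S_def)
    also have "\<dots> = (\<Sum>\<pi>\<in>Q. far_fraction m \<epsilon> (\<lambda>i. X i \<omega>)) / card Q"
      using far_fraction_permute[of _ "\<lambda>i. X i \<omega>"] X_space by (simp add: Q_def)
    also have "\<dots> = far_fraction m \<epsilon> (\<lambda>i. X i \<omega>)" using cardQ by simp
    also have "\<dots> = far_fraction m \<epsilon> (\<lambda>i\<in>{1..n}. X i \<omega>)"
      unfolding far_fraction_def using far_restrict[OF endpoints_subset] by simp
    finally show ?thesis .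
  qed
  \<comment> \<open>The true mean \<open>q\<close> is known only through
    \<open>q \<le> \<eta>\<close>. The deviation is therefore measured from \<open>q\<close>, and
    the exponent is weakened to \<open>t - \<eta>\<close> at the end.\<close>
  have "prob {\<omega> \<in> space P. q + (t - q) \<le> (\<Sum>B\<in>S. (\<Sum>\<pi> | \<pi> permutes {1..n}. g B (\<lambda>i\<in>V B. X (\<pi> i) \<omega>))
      / card {\<pi>. \<pi> permutes {1..n}}) / card S} \<le> exp (- 2 * real r * (t - q)\<^sup>2)"
    unfolding q_def
  proof (rule prob_permutation_average_ge_le[OF finS S_ne r(1)])
    show "0 < t - (\<Sum>B\<in>S. expectation (\<lambda>\<omega>. g B (\<lambda>i\<in>V B. X i \<omega>))) / card S"
      using q \<open>\<eta> < t\<close> by (simp add: q_def)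
    fix B assume B: "B \<in> S"
    show "V B \<subseteq> {1..n}" using endpoints_subset B by (simp add: V_def S_def)
    have "r * card (V B) \<le> r * (2 * m)"
      using card_Union_endpoints_le[of B n m] B by (intro mult_left_mono) (auto simp: V_def S_def)
    also have "\<dots> \<le> card {1..n}" using r by simp
    finally show "r * card (V B) \<le> card {1..n}" .
    show "g B \<in> borel_measurable (Pi\<^sub>M (V B) (\<lambda>_. Z))"
      unfolding g_def[abs_def] using far_meas[of B "V B" m \<epsilon>] by (simp add: V_def)
    show "g B x \<in> {0..1}" for x by (simp add: g_def)
  qed
  also have "{\<omega> \<in> space P. q + (t - q) \<le> (\<Sum>B\<in>S. (\<Sum>\<pi> | \<pi> permutes {1..n}. g B (\<lambda>i\<in>V B. X (\<pi> i) \<omega>))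
      / card {\<pi>. \<pi> permutes {1..n}}) / card S}
      = {\<omega> \<in> space P. t \<le> far_fraction m \<epsilon> (\<lambda>i\<in>{1..n}. X i \<omega>)}"
    using p unfolding Q_def by auto
  also have "exp (- 2 * real r * (t - q)\<^sup>2) \<le> exp (- 2 * real r * (t - \<eta>)\<^sup>2)"
  proof -
    have "(t - \<eta>)\<^sup>2 \<le> (t - q)\<^sup>2" using q \<open>\<eta> < t\<close> by (intro power_mono) auto
    then have "real r * (t - \<eta>)\<^sup>2 \<le> real r * (t - q)\<^sup>2" by (intro mult_left_mono) auto
    then show ?thesis by simp
  qed
  finally show ?thesis .
qed

section \<open>The estimator as a function of blocks and sample\<close>

text \<open>Independence of blocks and sample is stated for the restricted vectors, which are points
  of product spaces. The estimator reads no other coordinates.\<close>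

lemma MoIU_restrict:
  assumes "\<And>k. k \<in> {1..K} \<Longrightarrow> b k \<in> pair_blocks n m"
  shows "MoIU K m h (\<lambda>i\<in>{1..n}. y i) (\<lambda>k\<in>{1..K}. b k) = MoIU K m h y b"
proof -
  have "map (\<lambda>k. incomplete_U m h (\<lambda>i\<in>{1..n}. y i) ((\<lambda>k\<in>{1..K}. b k) k)) [1..<Suc K]
      = map (\<lambda>k. incomplete_U m h y (b k)) [1..<Suc K]"
  proof (rule map_cong[OF refl])
    fix k assume "k \<in> set [1..<Suc K]"
    then have "k \<in> {1..K}" by auto
    then show "incomplete_U m h (\<lambda>i\<in>{1..n}. y i) ((\<lambda>k\<in>{1..K}. b k) k) = incomplete_U m h y (b k)"
      using incomplete_U_restrict[OF endpoints_subset[OF assms]] by simp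
  qed
  then show ?thesis by (simp only: MoIU_def)
qed

lemma MoIU_far_count:
  assumes "0 < K" and "\<bar>MoIU K m h y b - theta P X h\<bar> > \<epsilon>"
  shows "K \<le> 2 * card {k \<in> {1..K}. far m \<epsilon> (b k) y}"
proof -
  define xs where "xs = map (\<lambda>k. incomplete_U m h y (b k)) [1..<Suc K]"
  have len: "length xs = K" by (simp add: xs_def)
  then have "xs \<noteq> []" using \<open>0 < K\<close> by auto
  from median_deviation_count[OF this, of \<epsilon> "theta P X h"] assms(2)
  have "K \<le> 2 * length (filter (\<lambda>x. \<bar>x - theta P X h\<bar> > \<epsilon>) xs)"
    by (simp add: MoIU_def xs_def len[unfolded xs_def] del: upt_Suc)
  also have "length (filter (\<lambda>x. \<bar>x - theta P X h\<bar> > \<epsilon>) xs)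
      = length (filter (\<lambda>k. far m \<epsilon> (b k) y) [1..<Suc K])"
    by (simp add: xs_def filter_map comp_def far_def del: upt_Suc)
  also have "\<dots> = card (set (filter (\<lambda>k. far m \<epsilon> (b k) y) [1..<Suc K]))"
    by (rule distinct_card[symmetric]) simp
  also have "set (filter (\<lambda>k. far m \<epsilon> (b k) y) [1..<Suc K]) = {k \<in> {1..K}. far m \<epsilon> (b k) y}"
    by auto
  finally show ?thesis .
qed

text \<open>Joint measurability, needed for Fubini. A block ranges over a finite set, so it suffices
  to treat the U-statistic of each fixed block as a function of the sample.\<close>

lemma MoIU_meas:
  "(\<lambda>p. MoIU K m h (snd p) (fst p))
    \<in> borel_measurable (Pi\<^sub>M {1..K} (\<lambda>_. count_space (pair_blocks n m)) \<Otimes>\<^sub>M Pi\<^sub>M {1..n} (\<lambda>_. Z))"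
    (is "_ \<in> borel_measurable ?R")
proof -
  have U: "(\<lambda>p. incomplete_U m h (snd p) (fst p k)) \<in> borel_measurable ?R" if "k \<in> {1..K}" for k
  proof (rule measurable_compose_countable'[where I = "pair_blocks n m"])
    show "(\<lambda>p. incomplete_U m h (snd p) B) \<in> borel_measurable ?R" if "B \<in> pair_blocks n m" for B
      by (rule measurable_compose[OF measurable_snd incomplete_U_meas[OF endpoints_subset[OF that]]])
    show "(\<lambda>p. fst p k) \<in> measurable ?R (count_space (pair_blocks n m))"
      using that by measurable
    show "countable (pair_blocks n m)" by (simp add: finite_pair_blocks countable_finite)
  qed
  have "(\<lambda>p. sample_median (map (\<lambda>f. f p) (map (\<lambda>k p. incomplete_U m h (snd p) (fst p k)) [1..<Suc K])))
      \<in> borel_measurable ?R"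
    by (rule borel_measurable_sample_median) (use U in auto)
  then show ?thesis by (simp add: MoIU_def comp_def del: upt_Suc)
qed

text \<open>Samples whose fraction of far blocks reaches \<open>t\<close> are paid for by the
  concentration bound; for every other sample the count of far blocks is bounded with the sample
  frozen.\<close>

lemma prob_MoIU_far_le:
  fixes J :: "nat \<Rightarrow> 'w \<Rightarrow> (nat \<times> nat) set"
  assumes m: "0 < m" "m \<le> card (index_pairs n)" and "0 < K" "0 \<le> \<epsilon>" "0 < \<eta>" "\<eta> < t" "t < 1 / 2"
    and bound: "sigma_sq P X h / m + 4 * sigma1_sq P Z X h / (real n + 1) \<le> \<eta> * \<epsilon>\<^sup>2"
    and r: "0 < r" "r * (2 * m) \<le> n"
    and J_indep: "indep_vars (\<lambda>_. count_space (pair_blocks n m)) J {1..K}"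
    and J_uniform: "\<And>k. k \<in> {1..K} \<Longrightarrow>
      distr P (count_space (pair_blocks n m)) (J k) = uniform_count_measure (pair_blocks n m)"
    and J_indep_X: "indep_set
      (sets (vimage_algebra (space P) (\<lambda>\<omega>. \<lambda>k\<in>{1..K}. J k \<omega>) (Pi\<^sub>M {1..K} (\<lambda>_. count_space (pair_blocks n m)))))
      (sets (vimage_algebra (space P) (\<lambda>\<omega>. \<lambda>i\<in>{1..n}. X i \<omega>) (Pi\<^sub>M {1..n} (\<lambda>_. Z))))"
  shows "{\<omega> \<in> space P. \<bar>MoIU K m h (\<lambda>i. X i \<omega>) (\<lambda>k. J k \<omega>) - theta P X h\<bar> > \<epsilon>} \<in> sets P"
    and "prob {\<omega> \<in> space P. \<bar>MoIU K m h (\<lambda>i. X i \<omega>) (\<lambda>k. J k \<omega>) - theta P X h\<bar> > \<epsilon>}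
      \<le> exp (- 2 * real r * (t - \<eta>)\<^sup>2) + exp (- 2 * real K * (1 / 2 - t)\<^sup>2)"
proof -
  define S where "S = pair_blocks n m"
  define JS where "JS = Pi\<^sub>M {1..K} (\<lambda>_. count_space S)"
  define XS where "XS = Pi\<^sub>M {1..n} (\<lambda>_. Z)"
  define Jv where "Jv \<omega> = (\<lambda>k\<in>{1..K}. J k \<omega>)" for \<omega>
  define Xv where "Xv \<omega> = (\<lambda>i\<in>{1..n}. X i \<omega>)" for \<omega>
  define W where "W = {p \<in> space (JS \<Otimes>\<^sub>M XS). \<bar>MoIU K m h (snd p) (fst p) - theta P X h\<bar> > \<epsilon>}"
  define G where "G = {y \<in> space XS. t \<le> far_fraction m \<epsilon> y}"
  have "card S = card (index_pairs n) choose m"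
    unfolding S_def pair_blocks_def by (rule n_subsets[OF finite_index_pairs])
  then have "0 < card S" using m by simp
  then have S: "finite S" "S \<noteq> {}" by (auto simp: S_def finite_pair_blocks)
  have J_meas: "J k \<in> measurable P (count_space S)" if "k \<in> {1..K}" for k
    using J_indep that by (auto simp: indep_vars_def S_def)
  have [measurable]: "Jv \<in> measurable P JS"
    unfolding Jv_def[abs_def] JS_def by (rule measurable_restrict) (rule J_meas)
  have [measurable]: "Xv \<in> measurable P XS"
    using measurable_subsample[of "\<lambda>i. i" "{1..n}"] by (simp add: Xv_def[abs_def] XS_def)
  have [measurable]: "(\<lambda>p. MoIU K m h (snd p) (fst p)) \<in> borel_measurable (JS \<Otimes>\<^sub>M XS)"
    using MoIU_meas by (simp add: JS_def XS_def S_def)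
  have W_meas [measurable]: "W \<in> sets (JS \<Otimes>\<^sub>M XS)" unfolding W_def by measurable
  have "Measurable.pred XS (far m \<epsilon> B)" if "B \<in> S" for B
    unfolding XS_def by (rule far_meas) (use that endpoints_subset in \<open>auto simp: S_def\<close>)
  then have [measurable]: "far_fraction m \<epsilon> \<in> borel_measurable XS"
    unfolding far_fraction_def[abs_def] S_def[symmetric] by measurable
  have G_meas [measurable]: "G \<in> sets XS" unfolding G_def by measurable
  have event: "{\<omega> \<in> space P. \<bar>MoIU K m h (\<lambda>i. X i \<omega>) (\<lambda>k. J k \<omega>) - theta P X h\<bar> > \<epsilon>}
      = {\<omega> \<in> space P. (Jv \<omega>, Xv \<omega>) \<in> W}"
  proof -
    have "MoIU K m h (Xv \<omega>) (Jv \<omega>) = MoIU K m h (\<lambda>i. X i \<omega>) (\<lambda>k. J k \<omega>)" if "\<omega> \<in> space P" for \<omega>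
      unfolding Xv_def Jv_def
      by (rule MoIU_restrict) (use measurable_space[OF J_meas that] in \<open>simp add: S_def\<close>)
    moreover have "(Jv \<omega>, Xv \<omega>) \<in> space (JS \<Otimes>\<^sub>M XS)" if "\<omega> \<in> space P" for \<omega>
      using that measurable_space[of Jv P JS] measurable_space[of Xv P XS]
      by (simp add: space_pair_measure)
    ultimately show ?thesis by (auto simp: W_def)
  qed
  show "{\<omega> \<in> space P. \<bar>MoIU K m h (\<lambda>i. X i \<omega>) (\<lambda>k. J k \<omega>) - theta P X h\<bar> > \<epsilon>} \<in> sets P"
    unfolding event by measurable
  have "prob {\<omega> \<in> space P. (Jv \<omega>, Xv \<omega>) \<in> W}
      \<le> prob {\<omega> \<in> space P. Xv \<omega> \<in> G} + exp (- 2 * real K * (1 / 2 - t)\<^sup>2)"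
  proof (rule prob_Pair_le_by_sections)
    show "indep_set (sets (vimage_algebra (space P) Jv JS)) (sets (vimage_algebra (space P) Xv XS))"
      using J_indep_X by (simp add: Jv_def[abs_def] Xv_def[abs_def] JS_def XS_def S_def)
    fix y assume y: "y \<in> space XS - G"
    \<comment> \<open>With the sample frozen at \<open>y\<close>, each block falls into
      \<open>A\<close> with probability \<open>far_fraction m \<epsilon> y\<close>, which is below
      \<open>t\<close> because \<open>y\<close> lies outside \<open>G\<close>.\<close>
    define A where "A = {B \<in> S. far m \<epsilon> B y}"
    have "card A / card S = far_fraction m \<epsilon> y"
      by (simp add: far_fraction_def A_def S_def of_bool_def sum.If_cases Int_def finite_pair_blocks)
    then have A: "A \<subseteq> S" "card A / card S \<le> t" using y by (auto simp: A_def G_def)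
    have sub: "{\<omega> \<in> space P. (Jv \<omega>, y) \<in> W} \<subseteq> {\<omega> \<in> space P. K \<le> 2 * card {k \<in> {1..K}. J k \<omega> \<in> A}}"
    proof safe
      fix \<omega> assume \<omega>: "\<omega> \<in> space P" and "(Jv \<omega>, y) \<in> W"
      then have "K \<le> 2 * card {k \<in> {1..K}. far m \<epsilon> (Jv \<omega> k) y}"
        by (intro MoIU_far_count[OF \<open>0 < K\<close>]) (simp add: W_def)
      also have "{k \<in> {1..K}. far m \<epsilon> (Jv \<omega> k) y} = {k \<in> {1..K}. J k \<omega> \<in> A}"
        using measurable_space[OF J_meas \<omega>] by (auto simp: Jv_def A_def)
      finally show "K \<le> 2 * card {k \<in> {1..K}. J k \<omega> \<in> A}" .
    qed
    \<comment> \<open>Measurability of the event: the size of a random index set is rewritten as a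
      sum of indicators.\<close>
    have "K \<le> 2 * card {k \<in> {1..K}. J k \<omega> \<in> A} \<longleftrightarrow> real K \<le> 2 * (\<Sum>k\<in>{1..K}. of_bool (J k \<omega> \<in> A))" for \<omega>
    proof -
      have "(\<Sum>k\<in>{1..K}. of_bool (J k \<omega> \<in> A)) = real (card {k \<in> {1..K}. J k \<omega> \<in> A})"
        by (simp add: of_bool_def sum.If_cases Int_def)
      then show ?thesis by linarith
    qed
    then have "{\<omega> \<in> space P. K \<le> 2 * card {k \<in> {1..K}. J k \<omega> \<in> A}}
        = {\<omega> \<in> space P. real K \<le> 2 * (\<Sum>k\<in>{1..K}. of_bool (J k \<omega> \<in> A))}" by simp
    also have "\<dots> \<in> sets P"
    proof -
      have "Measurable.pred P (\<lambda>\<omega>. J k \<omega> \<in> A)" if "k \<in> {1..K}" for k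
        using measurable_compose[OF J_meas[OF that], of "\<lambda>B. B \<in> A" "count_space UNIV"] by simp
      then show ?thesis by measurable
    qed
    finally have "{\<omega> \<in> space P. K \<le> 2 * card {k \<in> {1..K}. J k \<omega> \<in> A}} \<in> sets P" .
    from finite_measure_mono[OF sub this]
    have "prob {\<omega> \<in> space P. (Jv \<omega>, y) \<in> W} \<le> prob {\<omega> \<in> space P. K \<le> 2 * card {k \<in> {1..K}. J k \<omega> \<in> A}}" .
    also have "\<dots> \<le> exp (- 2 * real K * (1 / 2 - t)\<^sup>2)"
      by (rule prob_half_uniform_draws_le[OF S A \<open>t < 1 / 2\<close> \<open>0 < K\<close>])
        (use J_indep J_uniform in \<open>auto simp: S_def\<close>)
    finally show "prob {\<omega> \<in> space P. (Jv \<omega>, y) \<in> W} \<le> exp (- 2 * real K * (1 / 2 - t)\<^sup>2)" .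
  qed measurable
  also have "{\<omega> \<in> space P. Xv \<omega> \<in> G} = {\<omega> \<in> space P. t \<le> far_fraction m \<epsilon> (\<lambda>i\<in>{1..n}. X i \<omega>)}"
    using measurable_space[of Xv P XS] by (auto simp: G_def Xv_def)
  also have "prob \<dots> \<le> exp (- 2 * real r * (t - \<eta>)\<^sup>2)"
    by (rule prob_far_fraction_ge_le[OF m \<open>0 \<le> \<epsilon>\<close> \<open>0 < \<eta>\<close> \<open>\<eta> < t\<close> bound r])
  finally show "prob {\<omega> \<in> space P. \<bar>MoIU K m h (\<lambda>i. X i \<omega>) (\<lambda>k. J k \<omega>) - theta P X h\<bar> > \<epsilon>}
      \<le> exp (- 2 * real r * (t - \<eta>)\<^sup>2) + exp (- 2 * real K * (1 / 2 - t)\<^sup>2)"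
    unfolding event by simp
qed

end

theorem theorem3p2:
  fixes P :: "'w measure" and Z :: "'z measure"
    and X :: "nat \<Rightarrow> 'w \<Rightarrow> 'z" and h :: "'z \<Rightarrow> 'z \<Rightarrow> real"
    and J :: "nat \<Rightarrow> 'w \<Rightarrow> (nat \<times> nat) set"
    and \<delta> \<tau> :: real and n K M :: nat
  assumes "0 < \<delta>" "\<delta> < 1" "0 < \<tau>" "\<tau> < 1 / 2"
    and "0 < n" "0 < K" "0 < M"
    and "real n \<ge> 9 * ln (2 / \<delta>) / (2 * \<tau>^2)"
    and "real K \<ge> ln (2 / \<delta>) / (2 * (1 / 2 - \<tau>)^2)"
    and "int M = \<lfloor>2 * real n * \<tau>^2 / (9 * ln (2 / \<delta>))\<rfloor>"
    and "prob_space P"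
    and X_indep: "prob_space.indep_vars P (\<lambda>_. Z) X {1..n}"
    and X_ident: "\<And>i. i \<in> {1..n} \<Longrightarrow> distr P Z (X i) = distr P Z (X 1)"
    and h_measurable: "(\<lambda>(x, y). h x y) \<in> borel_measurable (Z \<Otimes>\<^sub>M Z)"
    and h_symmetric: "\<And>x y. x \<in> space Z \<Longrightarrow> y \<in> space Z \<Longrightarrow> h x y = h y x"
    and h_square_integrable: "integrable P (\<lambda>\<omega>. (h (X 1 \<omega>) (X 2 \<omega>))^2)"
    and J_indep: "prob_space.indep_vars P (\<lambda>_. count_space (pair_blocks n M)) J {1..K}"
    and J_uniform: "\<And>k. k \<in> {1..K} \<Longrightarrow>
      distr P (count_space (pair_blocks n M)) (J k) = uniform_count_measure (pair_blocks n M)"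
    and J_indep_X: "prob_space.indep_set P
      (sets (vimage_algebra (space P) (\<lambda>\<omega>. \<lambda>k\<in>{1..K}. J k \<omega>)
        (Pi\<^sub>M {1..K} (\<lambda>_. count_space (pair_blocks n M)))))
      (sets (vimage_algebra (space P) (\<lambda>\<omega>. \<lambda>i\<in>{1..n}. X i \<omega>)
        (Pi\<^sub>M {1..n} (\<lambda>_. Z))))"
  shows "prob_space.prob P {\<omega> \<in> space P.
      \<bar>MoIU K M h (\<lambda>i. X i \<omega>) (\<lambda>k. J k \<omega>) - theta P X h\<bar>
        \<le> sqrt (12 * sigma1_sq P Z X h / (real n * \<tau>)
               + 6 * sigma2_sq P Z X h / (\<tau> * real n * (real n - 1))
               + 27 * sigma_sq P X h * ln (2 / \<delta>) / (real n * \<tau>^3))} \<ge> 1 - \<delta>"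
proof -
  define L where "L = ln (2 / \<delta>)"
  define s s1 where "s = sigma_sq P X h" and "s1 = sigma1_sq P Z X h"
  define e where "e = 12 * s1 / (real n * \<tau>)
               + 6 * sigma2_sq P Z X h / (\<tau> * real n * (real n - 1))
               + 27 * s * L / (real n * \<tau>^3)"
  define x where "x = 2 * real n * \<tau>\<^sup>2 / (9 * L)"
  define r where "r = n div (2 * M)"
  note \<tau> = \<open>0 < \<tau>\<close> \<open>\<tau> < 1 / 2\<close>
  \<comment> \<open>From \<open>\<delta> < 1\<close> and \<open>\<tau> < 1 / 2\<close> come
    \<open>L > 2 / 3\<close> and \<open>\<tau>\<^sup>2 \<le> 1 / 4\<close>. So
    \<open>9 L / (4 \<tau>\<^sup>2)\<close> is at least 6 and \<open>n\<close> at least 12, which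
    settles all side conditions on small samples.\<close>
  have "ln 2 < L" unfolding L_def using assms(1,2) by (subst ln_less_cancel_iff) (auto simp: field_simps)
  then have L: "2 / 3 < L" using ln2_ge_two_thirds by simp
  have \<tau>_sq: "0 < \<tau>\<^sup>2" "\<tau>\<^sup>2 \<le> 1 / 4"
    using \<tau> power_mono[of \<tau> "1 / 2" 2] by (auto simp: power2_eq_square)
  have six: "6 \<le> 9 * L / (4 * \<tau>\<^sup>2)" using L \<tau>_sq by (simp add: field_simps)
  have "9 * L / (2 * \<tau>\<^sup>2) \<le> real n" using assms(8) by (simp add: L_def)
  then have n12: "12 \<le> real n" using six by simp
  have x_1: "1 \<le> x" using \<open>9 * L / (2 * \<tau>\<^sup>2) \<le> real n\<close> L \<tau>_sq by (simp add: x_def field_simps)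
  have M_floor: "real M \<le> x" "x < real M + 1"
    using assms(10) unfolding L_def[symmetric] x_def[symmetric] by linarith+
  \<comment> \<open>Since \<open>M\<close> is at least 1, taking the floor loses at most a factor
    2.\<close>
  have x_M: "x \<le> 2 * real M" using M_floor \<open>0 < M\<close> by linarith
  have inv_M: "1 / real M \<le> 9 * L / (real n * \<tau>\<^sup>2)"
    using x_M \<open>0 < M\<close> L \<tau>_sq n12 by (simp add: x_def field_simps)
  have x_n: "6 * x \<le> real n"
  proof -
    have "6 * (4 * \<tau>\<^sup>2) \<le> 9 * L" using six \<tau>_sq by (simp add: field_simps)
    then have "12 * \<tau>\<^sup>2 \<le> 9 * L" using \<tau>_sq by linarith
    then have "real n * (12 * \<tau>\<^sup>2) \<le> real n * (9 * L)" by (intro mult_left_mono) auto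
    then show ?thesis using L by (simp add: x_def field_simps)
  qed
  \<comment> \<open>Without this there would be no block of \<open>M\<close> distinct pairs to
    draw.\<close>
  have M_pairs: "M \<le> card (index_pairs n)"
  proof -
    have "M \<le> n" using M_floor x_n x_1 by linarith
    moreover have "n * 2 \<le> n * (n - 1)" using n12 by (intro mult_le_mono2) linarith
    ultimately show ?thesis using card_index_pairs[of n] by linarith
  qed
  interpret kernel_sample P Z X n h
  proof (intro kernel_sample.intro iid_sample.intro kernel_sample_axioms.intro iid_sample_axioms.intro)
    show "distr P Z (X i) = distr P Z (X j)" if "i \<in> {1..n}" "j \<in> {1..n}" for i j
      using X_ident[OF that(1)] X_ident[OF that(2)] by (rule trans[OF _ sym])
    show "3 \<le> n" using n12 by linarith
    show "prob_space P" by fact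
    show "prob_space.indep_vars P (\<lambda>_. Z) X {1..n}" by (rule X_indep)
    show "(\<lambda>(x, y). h x y) \<in> borel_measurable (Z \<Otimes>\<^sub>M Z)" by (rule h_measurable)
    show "h x y = h y x" if "x \<in> space Z" "y \<in> space Z" for x y by (rule h_symmetric[OF that])
    show "integrable P (\<lambda>\<omega>. (h (X 1 \<omega>) (X 2 \<omega>))\<^sup>2)" by (rule h_square_integrable)
  qed simp
  have bound: "s / M + 4 * s1 / (real n + 1) \<le> \<tau> / 3 * e"
  proof -
    \<comment> \<open>Scaled by \<open>\<tau> / 3\<close>, the first two terms are exactly the
      variance of the complete U-statistic, and the third is the bound for
      \<open>\<sigma>\<^sup>2 / M\<close>.\<close>
    have e_eq: "\<tau> / 3 * e = 4 * s1 / n + 2 * (s - 2 * s1) / (real n * (real n - 1)) + s * (9 * L / (real n * \<tau>\<^sup>2))"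
      using \<tau> n12 by (simp add: e_def sigma2_sq_def s_def s1_def field_simps power3_eq_cube power2_eq_square)
    have "s / M \<le> s * (9 * L / (real n * \<tau>\<^sup>2))"
      using mult_left_mono[OF inv_M, of s] sigma_sq_nonneg by (simp add: s_def)
    moreover have "4 * s1 / (real n + 1) \<le> 4 * s1 / n + 2 * (s - 2 * s1) / (real n * (real n - 1))"
    proof -
      \<comment> \<open>Over the common denominator \<open>n (n - 1) (n + 1)\<close> the difference
        of the two sides is \<open>2 ((n + 1) s - 4 s1)\<close>, which is nonnegative by
        \<open>s1 \<le> s\<close>.\<close>
      have "4 * s1 \<le> (real n + 1) * s"
        using sigma1_sq_le_sigma_sq sigma1_sq_nonneg n12 mult_mono[of 4 "real n + 1" s1 s]
        by (simp add: s_def s1_def)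
      then have "0 \<le> 2 * ((real n + 1) * s - 4 * s1) / (real n * (real n - 1) * (real n + 1))"
        using n12 by (intro divide_nonneg_nonneg mult_nonneg_nonneg) auto
      also have "\<dots> = 4 * s1 / n + 2 * (s - 2 * s1) / (real n * (real n - 1)) - 4 * s1 / (real n + 1)"
        using n12 by (simp add: divide_simps) (simp add: algebra_simps)
      finally show ?thesis by simp
    qed
    ultimately show ?thesis unfolding e_eq by linarith
  qed
  \<comment> \<open>The sign of \<open>e\<close> is read off the bound and not term by term, since
    \<open>sigma2_sq\<close> is a difference.\<close>
  have "0 \<le> s / M + 4 * s1 / (real n + 1)"
    using sigma_sq_nonneg sigma1_sq_nonneg by (simp add: s_def s1_def)
  with bound have "0 \<le> \<tau> / 3 * e" by linarith
  then have "0 \<le> e" using \<tau> by (simp add: zero_le_mult_iff)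
  have r_bound: "9 * L / (8 * \<tau>\<^sup>2) \<le> real r"
  proof -
    have "9 * L / (4 * \<tau>\<^sup>2) * (2 * real M) \<le> 9 * L / (4 * \<tau>\<^sup>2) * (2 * x)"
      using M_floor L by (intro mult_left_mono) auto
    also have "\<dots> = real n" using L \<tau>_sq by (simp add: x_def)
    finally have "9 * L / (4 * \<tau>\<^sup>2) \<le> real n / real (2 * M)"
      using \<open>0 < M\<close> by (simp add: pos_le_divide_eq)
    moreover have "real n / real (2 * M) < real r + 1"
      unfolding r_def using floor_divide_of_nat_eq[of n "2 * M", where 'a = real] by linarith
    ultimately have "9 * L / (4 * \<tau>\<^sup>2) < real r + 1" by linarith
    moreover have "9 * L / (4 * \<tau>\<^sup>2) = 2 * (9 * L / (8 * \<tau>\<^sup>2))" by simp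
    \<comment> \<open>Rounding \<open>n / (2 M)\<close> down loses less than 1, hence at most half
      of a quantity that is at least 6.\<close>
    ultimately show ?thesis using six by linarith
  qed
  have "0 < 9 * L / (8 * \<tau>\<^sup>2)" using L \<tau>_sq by simp
  with r_bound have r: "0 < r" "r * (2 * M) \<le> n" by (auto simp: r_def)
  have exp_L: "exp (- L) = \<delta> / 2" using assms(1) by (simp add: L_def exp_minus)
  have exp_r: "exp (- 2 * real r * (\<tau> - \<tau> / 3)\<^sup>2) \<le> \<delta> / 2"
  proof -
    \<comment> \<open>The fluctuation allowed above the mean bound \<open>\<tau> / 3\<close> is
      \<open>2 \<tau> / 3\<close>; its square cancels the constant \<open>9 / 8\<close> in the bound
      on \<open>r\<close>.\<close>
    have "L = 2 * (9 * L / (8 * \<tau>\<^sup>2)) * (\<tau> - \<tau> / 3)\<^sup>2" using \<tau> by (simp add: power2_eq_square field_simps)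
    also have "\<dots> \<le> 2 * real r * (\<tau> - \<tau> / 3)\<^sup>2" by (intro mult_right_mono mult_left_mono r_bound) auto
    finally have "exp (- 2 * real r * (\<tau> - \<tau> / 3)\<^sup>2) \<le> exp (- L)" by simp
    then show ?thesis using exp_L by simp
  qed
  have exp_K: "exp (- 2 * real K * (1 / 2 - \<tau>)\<^sup>2) \<le> \<delta> / 2"
  proof -
    have "0 < (1 / 2 - \<tau>)\<^sup>2" using \<tau> by simp
    then have "L \<le> 2 * real K * (1 / 2 - \<tau>)\<^sup>2"
      using assms(9) by (simp add: L_def pos_divide_le_eq mult_ac)
    then have "exp (- 2 * real K * (1 / 2 - \<tau>)\<^sup>2) \<le> exp (- L)" by simp
    then show ?thesis using exp_L by simp
  qed
  have bound': "sigma_sq P X h / M + 4 * sigma1_sq P Z X h / (real n + 1) \<le> \<tau> / 3 * (sqrt e)\<^sup>2"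
    using bound \<open>0 \<le> e\<close> by (simp add: s_def s1_def)
  have hyps: "0 \<le> sqrt e" "0 < \<tau> / 3" "\<tau> / 3 < \<tau>" using \<open>0 \<le> e\<close> \<tau> by auto
  define bad where "bad = {\<omega> \<in> space P. \<bar>MoIU K M h (\<lambda>i. X i \<omega>) (\<lambda>k. J k \<omega>) - theta P X h\<bar> > sqrt e}"
  note far = prob_MoIU_far_le[OF \<open>0 < M\<close> M_pairs \<open>0 < K\<close> hyps \<tau>(2) bound' r J_indep J_uniform J_indep_X]
  have "bad \<in> sets P" unfolding bad_def by (rule far(1))
  have "prob bad \<le> \<delta>" using far(2) exp_r exp_K unfolding bad_def by linarith
  have "{\<omega> \<in> space P. \<bar>MoIU K M h (\<lambda>i. X i \<omega>) (\<lambda>k. J k \<omega>) - theta P X h\<bar> \<le> sqrt e} = space P - bad"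
    by (auto simp: bad_def)
  then have "prob {\<omega> \<in> space P. \<bar>MoIU K M h (\<lambda>i. X i \<omega>) (\<lambda>k. J k \<omega>) - theta P X h\<bar> \<le> sqrt e} \<ge> 1 - \<delta>"
    using prob_compl[OF \<open>bad \<in> sets P\<close>] \<open>prob bad \<le> \<delta>\<close> by simp
  then show ?thesis by (simp add: e_def s_def s1_def L_def)
qed

end
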